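(* Let $m,n\in\mathbb N$, and let $\sigma\in\mathcal{PB}_{nm}$ with $r=\operatorname{rank}(\sigma)$. Then $$\mathbb E(\mathcal{PB}_{mn}^\sigma)=E(D_r^\sigma\cup D_{r-1}^\sigma)\cup\bigcup_{q=0}^{r-2}D_q^\sigma.$$
   Context: $\mathbb N=\{0,1,2,\ldots\}$, $[n]=\{1,\ldots,n\}$ (with $[0]=\emptyset$), and $A'=\{a':a\in A\}$, $A''=\{a'':a\in A\}$ for $A\subseteq\mathbb N$. $\mathcal{PB}_{mn}$ is the set of all partial Brauer partitions, i.e. set partitions of $[m]\cup[n]'$ into blocks of size $1$ or $2$. For $\alpha\in\mathcal{PB}_{mn}$ and $\beta\in\mathcal{PB}_{nk}$, the product $\alpha\beta\in\mathcal{PB}_{mk}$ is formed as follows: identify partitions with graphs whose connected components are the blocks; let $\alpha_\downarrow$ be the graph on $[m]\cup[n]''$ obtained from $\alpha$ by renaming each $x'$ to $x''$, let $\beta^\uparrow$ be the graph on $[n]''\cup[k]'$ obtained from $\beta$ by renaming each $x\in[n]$ to $x''$, and let $\Pi(\alpha,\beta)$ be their union on $[m]\cup[n]''\cup[k]'$; two elements of $[m]\cup[k]'$ are in the same block of $\alpha\beta$ iff they are in the same component of $\Pi(\alpha,\beta)$. The rank of $\alpha\in\mathcal{PB}_{mn}$ is the number of blocks meeting both $[m]$ and $[n]'$. For $\sigma\in\mathcal{PB}_{nm}$, $\mathcal{PB}_{mn}^\sigma$ is the set $\mathcal{PB}_{mn}$ with operation $\alpha\star_\sigma\beta=\alpha\sigma\beta$.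 $P^\sigma=\operatorname{Reg}(\mathcal{PB}_{mn}^\sigma)$ is the subsemigroup of (von Neumann) regular elements of $\mathcal{PB}_{mn}^\sigma$, and $D_q^\sigma=\{\alpha\in P^\sigma:\operatorname{rank}(\alpha)=q\}$ (empty if $q<0$). For a subset $A$ of $\mathcal{PB}_{mn}^\sigma$, $E(A)$ is the set of $\star_\sigma$-idempotents contained in $A$. $\mathbb E(T)$ is the subsemigroup generated by all idempotents of a semigroup $T$. *)

theory Defs
  imports "HOL-Library.Disjoint_Sets"
begin

text \<open>The three disjoint copies of \<open>\<nat>\<close>: \<open>Plain x\<close>, \<open>Primed x\<close>, \<open>DPrimed x\<close>
  stand for \<open>x\<close>, \<open>x'\<close>, \<open>x''\<close>.\<close>

datatype vertex = Plain nat | Primed nat | DPrimed nat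

definition verts :: "nat \<Rightarrow> nat \<Rightarrow> vertex set" where
  "verts m n = Plain ` {1..m} \<union> Primed ` {1..n}"

definition PB :: "nat \<Rightarrow> nat \<Rightarrow> vertex set set set" where
  "PB m n = {\<alpha>. partition_on (verts m n) \<alpha> \<and> (\<forall>B\<in>\<alpha>. card B = 1 \<or> card B = 2)}"

primrec lower_to_mid :: "vertex \<Rightarrow> vertex" where
  "lower_to_mid (Plain x) = Plain x"
| "lower_to_mid (Primed x) = DPrimed x"
| "lower_to_mid (DPrimed x) = DPrimed x"

primrec upper_to_mid :: "vertex \<Rightarrow> vertex" where
  "upper_to_mid (Plain x) = DPrimed x"
| "upper_to_mid (Primed x) = Primed x"
| "upper_to_mid (DPrimed x) = DPrimed x"

text \<open>Edges of the graph of a partition: any two vertices of a common block are joined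
  (loops included, which does not affect connectivity).\<close>

definition block_edges :: "vertex set set \<Rightarrow> (vertex \<times> vertex) set" where
  "block_edges \<alpha> = (\<Union>B\<in>\<alpha>. B \<times> B)"

definition product_graph :: "vertex set set \<Rightarrow> vertex set set \<Rightarrow> (vertex \<times> vertex) set" where
  "product_graph \<alpha> \<beta> =
     block_edges ((`) lower_to_mid ` \<alpha>) \<union> block_edges ((`) upper_to_mid ` \<beta>)"

text \<open>The product of \<open>\<alpha> \<in> PB m n\<close> and \<open>\<beta> \<in> PB n k\<close>. The edge relation is symmetric, so
  its reflexive transitive closure relates exactly the vertices in a common component.\<close>

definition pb_prod :: "nat \<Rightarrow> nat \<Rightarrow> vertex set set \<Rightarrow> vertex set set \<Rightarrow> vertex set set" where
  "pb_prod m k \<alpha> \<beta> =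
     verts m k // {(x, y). x \<in> verts m k \<and> y \<in> verts m k \<and> (x, y) \<in> (product_graph \<alpha> \<beta>)\<^sup>*}"

definition pb_rank :: "vertex set set \<Rightarrow> nat" where
  "pb_rank \<alpha> = card {B \<in> \<alpha>. B \<inter> range Plain \<noteq> {} \<and> B \<inter> range Primed \<noteq> {}}"

definition sandwich ::
  "nat \<Rightarrow> nat \<Rightarrow> vertex set set \<Rightarrow> vertex set set \<Rightarrow> vertex set set \<Rightarrow> vertex set set" where
  "sandwich m n \<sigma> \<alpha> \<beta> = pb_prod m n (pb_prod m m \<alpha> \<sigma>) \<beta>"

text \<open>Semigroups are given by a carrier and an operation.\<close>

definition regular_elements :: "('a \<Rightarrow> 'a \<Rightarrow> 'a) \<Rightarrow> 'a set \<Rightarrow> 'a set" where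
  "regular_elements mul S = {a \<in> S. \<exists>b\<in>S. mul (mul a b) a = a}"

definition idempotents :: "('a \<Rightarrow> 'a \<Rightarrow> 'a) \<Rightarrow> 'a set \<Rightarrow> 'a set" where
  "idempotents mul A = {a \<in> A. mul a a = a}"

inductive_set generated_subsemigroup :: "('a \<Rightarrow> 'a \<Rightarrow> 'a) \<Rightarrow> 'a set \<Rightarrow> 'a set"
  for mul :: "'a \<Rightarrow> 'a \<Rightarrow> 'a" and X :: "'a set" where
  gen: "a \<in> X \<Longrightarrow> a \<in> generated_subsemigroup mul X"
| mult: "a \<in> generated_subsemigroup mul X \<Longrightarrow> b \<in> generated_subsemigroup mul X \<Longrightarrow>
    mul a b \<in> generated_subsemigroup mul X"

definition idempotent_generated :: "('a \<Rightarrow> 'a \<Rightarrow> 'a) \<Rightarrow> 'a set \<Rightarrow> 'a set" where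
  "idempotent_generated mul S = generated_subsemigroup mul (idempotents mul S)"

definition PReg :: "nat \<Rightarrow> nat \<Rightarrow> vertex set set \<Rightarrow> vertex set set set" where
  "PReg m n \<sigma> = regular_elements (sandwich m n \<sigma>) (PB m n)"

text \<open>The rank index is an integer, so that the set is empty for negative \<open>q\<close>.\<close>

definition DReg :: "nat \<Rightarrow> nat \<Rightarrow> vertex set set \<Rightarrow> int \<Rightarrow> vertex set set set" where
  "DReg m n \<sigma> q = {\<alpha> \<in> PReg m n \<sigma>. int (pb_rank \<alpha>) = q}"

end

theory Submission
  imports Defs
begin

text \<open>The product \<open>\<alpha>\<beta>\<close> makes the partial Brauer partitions into a category in which every morphism
  is von Neumann regular: \<open>\<alpha>\<rho>\<alpha> = \<alpha>\<close> when \<open>\<rho>\<close> consists of the transversals of \<open>\<alpha>\<close> run backwards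
  (\<open>glue_regular\<close>).  For \<open>\<sigma>\<close> of rank \<open>r\<close> this yields morphisms \<open>P \<in> PB r n\<close> and \<open>Q \<in> PB m r\<close> with
  \<open>P\<sigma>Q = 1\<close> and \<open>\<sigma>QP\<sigma> = \<sigma>\<close> (\<open>sandwich_factor\<close>).  Then \<open>\<Phi> \<alpha> = P\<sigma>\<alpha>\<sigma>Q\<close> is a homomorphism from the
  sandwich semigroup to the partial Brauer monoid \<open>PB r r\<close>.  It preserves the rank of regular
  elements, a regular \<open>\<alpha>\<close> is idempotent as soon as \<open>\<Phi> \<alpha>\<close> is, and \<open>x \<mapsto> QxP\<close> turns idempotents of
  \<open>PB r r\<close> into idempotents of the sandwich semigroup.  If \<open>\<alpha> = \<alpha>\<sigma>\<beta>\<sigma>\<alpha>\<close>, then \<open>\<alpha>\<close> is the sandwich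
  product of the idempotent \<open>\<alpha>\<sigma>\<beta>\<close>, the element \<open>Q(\<Phi> \<alpha>)P\<close> and the idempotent \<open>\<beta>\<sigma>\<alpha>\<close>.  Regular elements
  form a subsemigroup, so everything reduces to the following two facts about \<open>PB r r\<close>.

  An element of rank at least \<open>r - 1\<close> has no room for a block of size two inside one row, so it is
  a partial injection, and if idempotent, a partial identity.  As rank does not increase in
  products, a product of idempotents whose rank is at least \<open>r - 1\<close> is a product of partial
  identities, hence a partial identity (\<open>generated_high_rank\<close>).

  Every element of rank at most \<open>r - 2\<close> is a product of idempotents (\<open>low_rank_generated\<close>).  By
  regularity this reduces to partial injections, which are viewed as rearrangements of tokens on
  \<open>r\<close> places.  Moving a single token is a product of three idempotents as long as there are two
  free places (\<open>IG_move\<close>), and every rearrangement is a sequence of such moves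
  (\<open>PI_low_rank_generated\<close>).

  All this is carried out for equivalence relations on two disjoint rows of points instead of
  partitions of vertices, because the product then becomes a total associative operation.\<close>

section \<open>Composition of relations on two-row diagrams\<close>

text \<open>Upper points are \<open>Inl x\<close>, lower points \<open>Inr y\<close>.  The map \<open>place a b\<close> puts the upper row
  on level \<open>a\<close> and the lower row on level \<open>b\<close> of a many-storeyed diagram.\<close>

definition place :: "nat \<Rightarrow> nat \<Rightarrow> nat + nat \<Rightarrow> nat \<times> nat" where
  "place a b = case_sum (Pair a) (Pair b)"

text \<open>The edges of \<open>R\<close>, drawn between the levels \<open>a\<close> and \<open>b\<close>.\<close>

definition layer :: "nat \<Rightarrow> nat \<Rightarrow> (nat + nat) rel \<Rightarrow> (nat \<times> nat) rel" where
  "layer a b R = map_prod (place a b) (place a b) ` R"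

text \<open>The points that survive in the product: the upper ones of \<open>R\<close> and the lower ones of \<open>S\<close>.\<close>

definition outer :: "(nat + nat) rel \<Rightarrow> (nat + nat) rel \<Rightarrow> (nat + nat) set" where
  "outer R S = {Inl x | x. Inl x \<in> Field R} \<union> {Inr y | y. Inr y \<in> Field S}"

text \<open>Stack the diagram of \<open>R\<close> on that of \<open>S\<close> and record which outer points are connected.
  No hypothesis links the lower row of \<open>R\<close> and the upper row of \<open>S\<close>, so the product is total.\<close>

definition glue :: "(nat + nat) rel \<Rightarrow> (nat + nat) rel \<Rightarrow> (nat + nat) rel" (infixl "\<odot>" 70) where
  "R \<odot> S = {(p, q). p \<in> outer R S \<and> q \<in> outer R S \<and>
      (place 0 2 p, place 0 2 q) \<in> (layer 0 1 R \<union> layer 1 2 S)\<^sup>*}"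

lemma place_simps [simp]:
  "place a b (Inl x) = (a, x)" "place a b (Inr x) = (b, x)"
  by (simp_all add: place_def)

lemma glue_outer: "(p, q) \<in> R \<odot> S \<Longrightarrow> p \<in> outer R S \<and> q \<in> outer R S"
  by (simp add: glue_def)

lemma place_inject: "a \<noteq> b \<Longrightarrow> place a b p = place a b q \<longleftrightarrow> p = q"
  by (cases p; cases q) auto

lemma layerI: "(p, q) \<in> R \<Longrightarrow> (place a b p, place a b q) \<in> layer a b R"
  by (auto simp: layer_def)

lemma Inl_in_outer [simp]: "Inl x \<in> outer R S \<longleftrightarrow> Inl x \<in> Field R"
  and Inr_in_outer [simp]: "Inr x \<in> outer R S \<longleftrightarrow> Inr x \<in> Field S"
  by (auto simp: outer_def)

lemma rtrancl_image_mono: "(x, y) \<in> A\<^sup>* \<Longrightarrow> (f x, f y) \<in> (map_prod f f ` A)\<^sup>*"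
proof (induction rule: rtrancl_induct)
  case (step y z)
  then have "(f y, f z) \<in> map_prod f f ` A"
    by force
  with step show ?case
    by (meson rtrancl.rtrancl_into_rtrancl)
qed simp

lemma rtrancl_inj_image_iff:
  assumes "inj f"
  shows "(f x, f y) \<in> (map_prod f f ` A)\<^sup>* \<longleftrightarrow> (x, y) \<in> A\<^sup>*"
proof
  assume "(f x, f y) \<in> (map_prod f f ` A)\<^sup>*"
  then have "(inv f (f x), inv f (f y)) \<in> (map_prod (inv f) (inv f) ` map_prod f f ` A)\<^sup>*"
    by (rule rtrancl_image_mono)
  also have "map_prod (inv f) (inv f) ` map_prod f f ` A = A"
    using assms by (force simp: image_iff)
  finally show "(x, y) \<in> A\<^sup>*"
    using assms by simp
qed (rule rtrancl_image_mono)

lemma layer_shift: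
  fixes f :: "nat \<Rightarrow> nat"
  shows "map_prod (map_prod f id) (map_prod f id) ` layer a b R = layer (f a) (f b) R"
proof -
  have "map_prod f id \<circ> place a b = place (f a) (f b)"
    by (auto simp: place_def fun_eq_iff split: sum.splits)
  then show ?thesis
    by (simp add: layer_def image_comp flip: map_prod_compose)
qed

text \<open>The numbers of the three levels do not matter; this allows products to be nested inside a
  diagram with more levels.\<close>

lemma glue_levels:
  fixes f :: "nat \<Rightarrow> nat"
  assumes "inj f"
  shows "(p, q) \<in> R \<odot> S \<longleftrightarrow> p \<in> outer R S \<and> q \<in> outer R S \<and>
      (place (f 0) (f 2) p, place (f 0) (f 2) q) \<in> (layer (f 0) (f 1) R \<union> layer (f 1) (f 2) S)\<^sup>*"
proof -
  let ?g = "map_prod f (id :: nat \<Rightarrow> nat)"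
  have "inj ?g"
    using assms by (auto simp: inj_on_def)
  moreover have "?g (place 0 2 p) = place (f 0) (f 2) p" for p :: "nat + nat"
    by (cases p) auto
  ultimately show ?thesis
    using rtrancl_inj_image_iff[of ?g "place 0 2 p" "place 0 2 q" "layer 0 1 R \<union> layer 1 2 S"]
    by (simp add: glue_def image_Un layer_shift)
qed

text \<open>Passing to the transitive closure of one part of a graph, restricted to a set that contains
  the interface with the other part, does not change connectivity.\<close>

lemma rtrancl_Un_restrict:
  assumes Z: "Field P \<inter> Field Q \<subseteq> Z" and x: "x \<in> Z \<union> Field Q" and y: "y \<in> Z \<union> Field Q"
  shows "(x, y) \<in> (P\<^sup>* \<inter> Z \<times> Z \<union> Q)\<^sup>* \<longleftrightarrow> (x, y) \<in> (P \<union> Q)\<^sup>*"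
    (is "_ \<in> ?A\<^sup>* \<longleftrightarrow> _")
proof
  have "?A \<subseteq> (P \<union> Q)\<^sup>*"
    using rtrancl_mono[of P "P \<union> Q"] by auto
  then show "(x, y) \<in> ?A\<^sup>* \<Longrightarrow> (x, y) \<in> (P \<union> Q)\<^sup>*"
    by (metis rtrancl_subset_rtrancl subsetD)
next
  \<comment> \<open>A nontrivial path in \<open>P\<close> has its end points in \<open>Field P\<close>, hence in \<open>Z\<close>.\<close>
  have jump: "(z, w) \<in> ?A\<^sup>*" if "(z, w) \<in> P\<^sup>*" "z \<in> Z \<union> Field Q" "w \<in> Z \<union> Field Q" for z w
  proof (cases "z = w")
    case False
    then have "(z, w) \<in> P\<^sup>+"
      using that by (simp add: rtrancl_eq_or_trancl)
    then have "z \<in> Field P" "w \<in> Field P"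
      by (metis Field_def UnCI Domain.DomainI Range.RangeI trancl_domain trancl_range)+
    then show ?thesis
      using that Z by blast
  qed simp
  assume "(x, y) \<in> (P \<union> Q)\<^sup>*"
  \<comment> \<open>Along a path, keep the maximal final segment in \<open>P\<close> apart; it becomes a single edge of \<open>?A\<close>
    when the path enters \<open>Q\<close> or ends.\<close>
  then have "\<exists>z. (x, z) \<in> ?A\<^sup>* \<and> (z, y) \<in> P\<^sup>* \<and> z \<in> Z \<union> Field Q"
  proof (induction rule: rtrancl_induct)
    case base
    then show ?case using x by blast
  next
    case (step u v)
    then obtain z where z: "(x, z) \<in> ?A\<^sup>*" "(z, u) \<in> P\<^sup>*" "z \<in> Z \<union> Field Q"
      by blast
    show ?case
    proof (cases "(u, v) \<in> P")
      case True
      then show ?thesis using z by (meson rtrancl.rtrancl_into_rtrancl)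
    next
      case False
      then have uv: "(u, v) \<in> Q"
        using step by blast
      then have "(z, u) \<in> ?A\<^sup>*"
        using jump z by (metis FieldI1 UnCI)
      then have "(x, v) \<in> ?A\<^sup>*"
        using z uv by (meson UnCI rtrancl.rtrancl_into_rtrancl rtrancl_trans)
      then show ?thesis
        using uv by (metis FieldI2 UnCI rtrancl.rtrancl_refl)
    qed
  qed
  then show "(x, y) \<in> ?A\<^sup>*"
    using jump y by (meson rtrancl_trans)
qed

lemma Field_layer: "Field (layer a b R) = place a b ` Field R"
  unfolding layer_def Field_def by force

lemma Inl_in_Field_glue [simp]: "Inl x \<in> Field (R \<odot> S) \<longleftrightarrow> Inl x \<in> Field R"
  and Inr_in_Field_glue [simp]: "Inr x \<in> Field (R \<odot> S) \<longleftrightarrow> Inr x \<in> Field S"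
proof -
  have "p \<in> Field (R \<odot> S) \<longleftrightarrow> p \<in> outer R S" for p
    by (auto simp: glue_def Field_def)
  then show "Inl x \<in> Field (R \<odot> S) \<longleftrightarrow> Inl x \<in> Field R"
    "Inr x \<in> Field (R \<odot> S) \<longleftrightarrow> Inr x \<in> Field S"
    by auto
qed

lemma outer_glue [simp]: "outer (R \<odot> S) T = outer R T" "outer R (S \<odot> T) = outer R T"
  by (auto simp: outer_def)

lemma layer_glue:
  fixes f :: "nat \<Rightarrow> nat"
  assumes "inj f"
  shows "layer (f 0) (f 2) (R \<odot> S) =
    (layer (f 0) (f 1) R \<union> layer (f 1) (f 2) S)\<^sup>* \<inter>
      place (f 0) (f 2) ` outer R S \<times> place (f 0) (f 2) ` outer R S"
proof -
  have "f 0 \<noteq> f 2"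
    using assms by (simp add: inj_eq)
  then show ?thesis
    unfolding layer_def[of "f 0" "f 2"] by (force simp: glue_levels[OF assms])
qed

text \<open>Triple products are read off from a diagram with four levels.\<close>

lemma glue_glue_iff:
  "(p, q) \<in> R \<odot> S \<odot> T \<longleftrightarrow> p \<in> outer R T \<and> q \<in> outer R T \<and>
      (place 0 3 p, place 0 3 q) \<in> (layer 0 1 R \<union> layer 1 2 S \<union> layer 2 3 T)\<^sup>*"
proof (cases "p \<in> outer R T \<and> q \<in> outer R T")
  case True
  \<comment> \<open>The outer product \<open>(R \<odot> S) \<odot> T\<close> is drawn on the levels 0, 2, 3, which makes room for level 1.\<close>
  let ?f = "\<lambda>n :: nat. if n = 0 then 0 else Suc n"
  let ?Z = "place 0 2 ` outer R S" and ?P = "layer 0 1 R \<union> layer 1 2 S" and ?Q = "layer 2 3 T"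
  have "layer 0 2 (R \<odot> S) = ?P\<^sup>* \<inter> ?Z \<times> ?Z"
    using layer_glue[of id] by simp
  moreover have "Field ?P \<inter> Field ?Q \<subseteq> ?Z"
  proof
    fix v assume v: "v \<in> Field ?P \<inter> Field ?Q"
    then obtain y where y: "v = (2, y)" "Inr y \<in> Field S"
      by (auto simp: Field_layer place_def split: sum.splits)
    then show "v \<in> ?Z"
      by (intro image_eqI[of _ _ "Inr y"]) auto
  qed
  moreover have "place 0 3 s \<in> ?Z \<union> Field ?Q" if "s \<in> outer R T" for s
  proof (cases s)
    case (Inl x)
    then show ?thesis
      using that by (intro UnI1 image_eqI[of _ _ s]) auto
  next
    case (Inr x)
    then show ?thesis
      using that by (auto simp: Field_layer intro!: image_eqI[of _ _ s])
  qed
  ultimately have "(place 0 3 p, place 0 3 q) \<in> (layer 0 2 (R \<odot> S) \<union> ?Q)\<^sup>* \<longleftrightarrow>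
      (place 0 3 p, place 0 3 q) \<in> (?P \<union> ?Q)\<^sup>*"
    using True rtrancl_Un_restrict[of ?P ?Q ?Z] by simp
  moreover have "inj ?f"
    by (auto simp: inj_on_def)
  ultimately show ?thesis
    using True glue_levels[of ?f p q "R \<odot> S" T] by (simp flip: numeral_2_eq_2 numeral_3_eq_3)
qed (use glue_outer[of p q "R \<odot> S" T] in auto)

text \<open>The same four-level diagram describes the other bracketing, whence associativity.\<close>

lemma glue_glue_iff':
  "(p, q) \<in> R \<odot> (S \<odot> T) \<longleftrightarrow> p \<in> outer R T \<and> q \<in> outer R T \<and>
      (place 0 3 p, place 0 3 q) \<in> (layer 0 1 R \<union> layer 1 2 S \<union> layer 2 3 T)\<^sup>*"
proof (cases "p \<in> outer R T \<and> q \<in> outer R T")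
  case True
  let ?f = "\<lambda>n :: nat. if n \<le> 1 then n else Suc n"
  let ?Z = "place 1 3 ` outer S T" and ?P = "layer 1 2 S \<union> layer 2 3 T" and ?Q = "layer 0 1 R"
  have "layer 1 3 (S \<odot> T) = ?P\<^sup>* \<inter> ?Z \<times> ?Z"
    using layer_glue[of Suc] by (simp add: numeral_2_eq_2 numeral_3_eq_3)
  moreover have "Field ?P \<inter> Field ?Q \<subseteq> ?Z"
  proof
    fix v assume v: "v \<in> Field ?P \<inter> Field ?Q"
    then obtain y where y: "v = (1, y)" "Inl y \<in> Field S"
      by (auto simp: Field_layer place_def split: sum.splits)
    then show "v \<in> ?Z"
      by (intro image_eqI[of _ _ "Inl y"]) auto
  qed
  moreover have "place 0 3 s \<in> ?Z \<union> Field ?Q" if "s \<in> outer R T" for s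
  proof (cases s)
    case (Inl x)
    then show ?thesis
      using that by (auto simp: Field_layer intro!: image_eqI[of _ _ s])
  next
    case (Inr x)
    then show ?thesis
      using that by (intro UnI1 image_eqI[of _ _ s]) auto
  qed
  ultimately have "(place 0 3 p, place 0 3 q) \<in> (layer 1 3 (S \<odot> T) \<union> ?Q)\<^sup>* \<longleftrightarrow>
      (place 0 3 p, place 0 3 q) \<in> (?P \<union> ?Q)\<^sup>*"
    using True rtrancl_Un_restrict[of ?P ?Q ?Z] by simp
  moreover have "inj ?f"
    by (auto simp: inj_on_def)
  ultimately show ?thesis
    using True glue_levels[of ?f p q R "S \<odot> T"] by (simp add: Un_ac flip: numeral_2_eq_2 numeral_3_eq_3)
qed (use glue_outer[of p q R "S \<odot> T"] in auto)

interpretation glue: semigroup glue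
  by unfold_locales (intro equalityI subrelI; simp add: glue_glue_iff glue_glue_iff')

section \<open>The category of partial Brauer relations\<close>

text \<open>Row \<open>{1..m}\<close> on top, row \<open>{1..n}\<close> at the bottom.\<close>

definition pts :: "nat \<Rightarrow> nat \<Rightarrow> (nat + nat) set" where
  "pts m n = {1..m} <+> {1..n}"

text \<open>A partial Brauer partition is encoded by its equivalence relation; the second condition says
  that blocks have at most two elements.\<close>

definition Hom :: "nat \<Rightarrow> nat \<Rightarrow> (nat + nat) rel set" where
  "Hom m n = {R. equiv (pts m n) R \<and>
      (\<forall>p q q'. (p, q) \<in> R \<longrightarrow> (p, q') \<in> R \<longrightarrow> q = p \<or> q' = p \<or> q = q')}"

lemma pts_simps [simp]:
  "Inl x \<in> pts m n \<longleftrightarrow> x \<in> {1..m}" "Inr y \<in> pts m n \<longleftrightarrow> y \<in> {1..n}"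
  by (auto simp: pts_def)

lemma finite_pts [simp]: "finite (pts m n)"
  by (simp add: pts_def)

lemma HomI:
  assumes "\<And>p q. (p, q) \<in> R \<Longrightarrow> p \<in> pts m n"
    and "\<And>p. p \<in> pts m n \<Longrightarrow> (p, p) \<in> R"
    and "\<And>p q. (p, q) \<in> R \<Longrightarrow> (q, p) \<in> R"
    and "\<And>p q s. (p, q) \<in> R \<Longrightarrow> (q, s) \<in> R \<Longrightarrow> (p, s) \<in> R"
    and "\<And>p q q'. (p, q) \<in> R \<Longrightarrow> (p, q') \<in> R \<Longrightarrow> q = p \<or> q' = p \<or> q = q'"
  shows "R \<in> Hom m n"
proof -
  have "equiv (pts m n) R"
  proof (intro equivI refl_onI symI transI)
    show "R \<subseteq> pts m n \<times> pts m n"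
      using assms(1,3) by auto
  qed (fact assms(2-4))+
  then show ?thesis
    using assms(5) by (auto simp: Hom_def)
qed

lemma
  assumes "R \<in> Hom m n"
  shows Hom_refl: "p \<in> pts m n \<Longrightarrow> (p, p) \<in> R"
    and Hom_sym: "(p, q) \<in> R \<Longrightarrow> (q, p) \<in> R"
    and Hom_trans: "(p, q) \<in> R \<Longrightarrow> (q, s) \<in> R \<Longrightarrow> (p, s) \<in> R"
    and Hom_le_2: "(p, q) \<in> R \<Longrightarrow> (p, q') \<in> R \<Longrightarrow> q = p \<or> q' = p \<or> q = q'"
    and Hom_pts: "(p, q) \<in> R \<Longrightarrow> p \<in> pts m n \<and> q \<in> pts m n"
proof -
  have e: "equiv (pts m n) R"
    using assms by (simp add: Hom_def)
  show "p \<in> pts m n \<Longrightarrow> (p, p) \<in> R"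
    using e by (auto elim!: equivE dest: refl_onD)
  show "(p, q) \<in> R \<Longrightarrow> (q, p) \<in> R"
    using e by (meson equivE symD)
  show "(p, q) \<in> R \<Longrightarrow> (q, s) \<in> R \<Longrightarrow> (p, s) \<in> R"
    using e by (meson equivE transD)
  show "(p, q) \<in> R \<Longrightarrow> (p, q') \<in> R \<Longrightarrow> q = p \<or> q' = p \<or> q = q'"
    using assms unfolding Hom_def by blast
  show "(p, q) \<in> R \<Longrightarrow> p \<in> pts m n \<and> q \<in> pts m n"
    using e by (auto elim!: equivE)
qed

lemma Field_Hom: "R \<in> Hom m n \<Longrightarrow> Field R = pts m n"
  by (auto simp: Field_def dest: Hom_pts intro: Hom_refl)

lemma outer_Hom:
  assumes "R \<in> Hom m n" "S \<in> Hom k l"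
  shows "outer R S = pts m l"
  using assms by (auto simp: outer_def Field_Hom pts_def)

text \<open>In a graph of maximal degree 2, a component contains at most two vertices of degree at most 1:
  the vertices of a shortest path between two of them already form the whole component.\<close>

lemma leaves_of_component:
  assumes sym: "\<And>u v. (u, v) \<in> G \<Longrightarrow> (v, u) \<in> G"
    and degree: "\<And>v a b c. (v, a) \<in> G \<Longrightarrow> (v, b) \<in> G \<Longrightarrow> (v, c) \<in> G \<Longrightarrow>
      v \<notin> {a, b, c} \<Longrightarrow> a = b \<or> b = c \<or> a = c"
    and leaf: "\<And>v a b. v \<in> {x, y, z} \<Longrightarrow> (v, a) \<in> G \<Longrightarrow> (v, b) \<in> G \<Longrightarrow> v \<notin> {a, b} \<Longrightarrow> a = b"
    and xy: "(x, y) \<in> G\<^sup>*" and xz: "(x, z) \<in> G\<^sup>*"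
  shows "x = y \<or> y = z \<or> x = z"
proof (rule ccontr)
  assume distinct: "\<not> ?thesis"
  define n where "n = (LEAST n. (x, y) \<in> G ^^ n)"
  have n: "(x, y) \<in> G ^^ n" and n_le: "\<And>k. (x, y) \<in> G ^^ k \<Longrightarrow> n \<le> k"
    using xy unfolding n_def rtrancl_power by (auto intro: LeastI Least_le)
  obtain p where p: "p 0 = x" "p n = y" "\<And>i. i < n \<Longrightarrow> (p i, p (Suc i)) \<in> G"
    using n unfolding relpow_fun_conv by blast
  have walk: "(p i, p (i + d)) \<in> G ^^ d" if "i + d \<le> n" for i d
    unfolding relpow_fun_conv by (rule exI[of _ "\<lambda>t. p (i + t)"]) (use p(3) that in auto)
  have inj: "p i \<noteq> p j" if "i < j" "j \<le> n" for i j
  proof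
    assume eq: "p i = p j"
    have "(p 0, p i) \<in> G ^^ i" "(p j, p n) \<in> G ^^ (n - j)"
      using walk[of 0 i] walk[of j "n - j"] that by auto
    then have "(x, y) \<in> G ^^ (i + (n - j))"
      using eq p by (auto simp: relpow_add)
    then show False
      using n_le[of "i + (n - j)"] that by simp
  qed
  have inner: "(p i, p (i - 1)) \<in> G" "(p i, p (i + 1)) \<in> G" "p i \<notin> {p (i - 1), p (i + 1)}"
    "p (i - 1) \<noteq> p (i + 1)" if "0 < i" "i < n" for i
    using that p(3)[of i] p(3)[of "i - 1"] sym inj[of "i - 1" i] inj[of i "i + 1"]
      inj[of "i - 1" "i + 1"] by auto
  have "n > 0"
    using p distinct by (cases n) auto
  \<comment> \<open>The two neighbours of an inner vertex of the path, and the single neighbour of an end, already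
    lie on the path.\<close>
  have closed: "w \<in> p ` {..n}" if vw: "(v, w) \<in> G" and v: "v \<in> p ` {..n}" for v w
  proof (cases "w = v")
    case False
    from v obtain i where i: "i \<le> n" "v = p i"
      by auto
    then consider "i = 0" | "i = n" | "0 < i" "i < n"
      by linarith
    then show ?thesis
    proof cases
      case 1
      have "w = p 1"
        using leaf[of x w "p 1"] 1 i vw p(3)[of 0] p(1) False inj[of 0 1] \<open>n > 0\<close> by auto
      then show ?thesis
        using \<open>n > 0\<close> by auto
    next
      case 2
      have "w = p (n - 1)"
        using leaf[of y w "p (n - 1)"] 2 i vw sym[OF p(3)[of "n - 1"]] p(2) False inj[of "n - 1" n]
          \<open>n > 0\<close> by auto
      then show ?thesis
        by auto
    next
      case 3
      then have "w = p (i - 1) \<or> w = p (i + 1)"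
        using degree[of v w "p (i - 1)" "p (i + 1)"] inner[of i] i vw False by auto
      then show ?thesis
        using 3 by auto
    qed
  qed (use v in simp)
  from xz have "z \<in> p ` {..n}"
    by (induction rule: rtrancl_induct) (use p closed in \<open>blast+\<close>)
  then obtain i where i: "i \<le> n" "z = p i"
    by auto
  \<comment> \<open>So \<open>z\<close> is an inner vertex, with two different neighbours.\<close>
  then have "0 < i" "i < n"
    using distinct p by (auto intro: gr0I le_neq_trans)
  then show False
    using inner[of i] leaf[of z "p (i - 1)" "p (i + 1)"] i by auto
qed

lemma layer_cases:
  assumes "(v, w) \<in> layer a b R"
  obtains p q where "v = place a b p" "w = place a b q" "(p, q) \<in> R"
  using assms by (auto simp: layer_def)

lemma layer_sym: "R \<in> Hom m n \<Longrightarrow> (v, w) \<in> layer a b R \<Longrightarrow> (w, v) \<in> layer a b R"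
  by (auto simp: layer_def dest: Hom_sym)

lemma layer_degree:
  assumes R: "R \<in> Hom m n" and "a \<noteq> b"
    and "(v, w) \<in> layer a b R" "(v, w') \<in> layer a b R" "v \<notin> {w, w'}"
  shows "w = w'"
proof -
  obtain p q q' where "v = place a b p" "w = place a b q" "w' = place a b q'" "(p, q) \<in> R" "(p, q') \<in> R"
    using assms by (auto elim!: layer_cases simp: place_inject)
  then show ?thesis
    using Hom_le_2[OF R, of p q q'] assms(5) by auto
qed

lemma layer_levels: "(v, w) \<in> layer a b R \<Longrightarrow> fst v \<in> {a, b} \<and> fst w \<in> {a, b}"
  by (auto simp: layer_def place_def split: sum.splits)

text \<open>Blocks of a product have at most two elements: a point of the middle row meets at most one edge
  of each factor, an outer point meets at most one edge in all.\<close>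

lemma glue_Hom:
  assumes R: "R \<in> Hom m n" and S: "S \<in> Hom n k"
  shows "R \<odot> S \<in> Hom m k"
proof -
  let ?G = "layer 0 1 R \<union> layer 1 2 S"
  have sym: "(w, v) \<in> ?G" if "(v, w) \<in> ?G" for v w
    using that layer_sym[OF R] layer_sym[OF S] by blast
  then have sym': "sym (?G\<^sup>*)"
    by (intro sym_rtrancl symI)
  have leaf: "a = b" if "v \<in> range (place 0 2)" "(v, a) \<in> ?G" "(v, b) \<in> ?G" "v \<notin> {a, b}" for v a b
  proof -
    have "fst v = 0 \<or> fst v = 2"
      using that by (auto simp: place_def split: sum.splits)
    then have "(v, a) \<in> layer 0 1 R \<and> (v, b) \<in> layer 0 1 R \<or> (v, a) \<in> layer 1 2 S \<and> (v, b) \<in> layer 1 2 S"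
      using that layer_levels[of v _ 0 1 R] layer_levels[of v _ 1 2 S] by fastforce
    then show ?thesis
      using that layer_degree[OF R, of 0 1 v a b] layer_degree[OF S, of 1 2 v a b] by auto
  qed
  have degree: "a = b \<or> b = c \<or> a = c"
    if "(v, a) \<in> ?G" "(v, b) \<in> ?G" "(v, c) \<in> ?G" "v \<notin> {a, b, c}" for v a b c
  proof -
    have "x = y" if "(v, x) \<in> layer 0 1 R" "(v, y) \<in> layer 0 1 R" "v \<notin> {x, y}" for x y
      using layer_degree[OF R _ that] by simp
    moreover have "x = y" if "(v, x) \<in> layer 1 2 S" "(v, y) \<in> layer 1 2 S" "v \<notin> {x, y}" for x y
      using layer_degree[OF S _ that] by simp
    ultimately show ?thesis
      using that by blast
  qed
  have iff: "(p, q) \<in> R \<odot> S \<longleftrightarrow> p \<in> pts m k \<and> q \<in> pts m k \<and> (place 0 2 p, place 0 2 q) \<in> ?G\<^sup>*" for p q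
    by (simp add: glue_def outer_Hom[OF R S])
  show ?thesis
  proof (rule HomI)
    fix p q q' assume "(p, q) \<in> R \<odot> S" "(p, q') \<in> R \<odot> S"
    then have "(place 0 2 p, place 0 2 q) \<in> ?G\<^sup>*" "(place 0 2 p, place 0 2 q') \<in> ?G\<^sup>*"
      by (simp_all add: iff)
    then have "place 0 2 p = place 0 2 q \<or> place 0 2 q = place 0 2 q' \<or> place 0 2 p = place 0 2 q'"
      by (rule leaves_of_component[OF sym degree leaf, rotated -2]) blast+
    then show "q = p \<or> q' = p \<or> q = q'"
      by (auto simp: place_inject)
  qed (use sym' in \<open>auto simp: iff dest: symD intro: rtrancl_trans\<close>)
qed

text \<open>To identify a product, colour the points of the stacked diagram so that each factor is
  monochromatic along its edges: points of different colours are not connected.\<close>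

lemma glue_eqI:
  assumes outer: "\<And>p q. (p, q) \<in> T \<Longrightarrow> p \<in> outer R S \<and> q \<in> outer R S"
    and colour_R: "\<And>p q. (p, q) \<in> R \<Longrightarrow> case_sum c0 c1 p = case_sum c0 c1 q"
    and colour_S: "\<And>p q. (p, q) \<in> S \<Longrightarrow> case_sum c1 c2 p = case_sum c1 c2 q"
    and colour_T: "\<And>p q. p \<in> outer R S \<Longrightarrow> q \<in> outer R S \<Longrightarrow>
      case_sum c0 c2 p = case_sum c0 c2 q \<Longrightarrow> (p, q) \<in> T"
    and path: "\<And>p q. (p, q) \<in> T \<Longrightarrow>
      (place 0 2 p, place 0 2 q) \<in> (layer 0 1 R \<union> layer 1 2 S)\<^sup>*"
  shows "R \<odot> S = T"
proof -
  define c where "c v = (if fst v = 0 then c0 (snd v) else if fst v = 1 then c1 (snd v)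
    else c2 (snd v))" for v :: "nat \<times> nat"
  have c: "c (place 0 1 p) = case_sum c0 c1 p" "c (place 1 2 p) = case_sum c1 c2 p"
    "c (place 0 2 p) = case_sum c0 c2 p" for p
    by (cases p; simp add: c_def)+
  have step: "c v = c w" if "(v, w) \<in> layer 0 1 R \<union> layer 1 2 S" for v w
    using that colour_R colour_S by (auto elim!: layer_cases simp: c simp del: One_nat_def)
  have *: "c v = c w" if "(v, w) \<in> (layer 0 1 R \<union> layer 1 2 S)\<^sup>*" for v w
    using that by (induction rule: rtrancl_induct) (simp_all only: step)
  show ?thesis
  proof (intro equalityI subrelI)
    fix p q assume "(p, q) \<in> R \<odot> S"
    then have "p \<in> outer R S" "q \<in> outer R S" "c (place 0 2 p) = c (place 0 2 q)"
      using * unfolding glue_def by blast+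
    then show "(p, q) \<in> T"
      using colour_T by (simp only: c)
  next
    fix p q assume "(p, q) \<in> T"
    then show "(p, q) \<in> R \<odot> S"
      using outer path by (simp add: glue_def)
  qed
qed

lemma glue_glue_eqI:
  assumes outer: "\<And>p q. (p, q) \<in> T \<Longrightarrow> p \<in> outer R U \<and> q \<in> outer R U"
    and colour_R: "\<And>p q. (p, q) \<in> R \<Longrightarrow> case_sum c0 c1 p = case_sum c0 c1 q"
    and colour_S: "\<And>p q. (p, q) \<in> S \<Longrightarrow> case_sum c1 c2 p = case_sum c1 c2 q"
    and colour_U: "\<And>p q. (p, q) \<in> U \<Longrightarrow> case_sum c2 c3 p = case_sum c2 c3 q"
    and colour_T: "\<And>p q. p \<in> outer R U \<Longrightarrow> q \<in> outer R U \<Longrightarrow>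
      case_sum c0 c3 p = case_sum c0 c3 q \<Longrightarrow> (p, q) \<in> T"
    and path: "\<And>p q. (p, q) \<in> T \<Longrightarrow>
      (place 0 3 p, place 0 3 q) \<in> (layer 0 1 R \<union> layer 1 2 S \<union> layer 2 3 U)\<^sup>*"
  shows "R \<odot> S \<odot> U = T"
proof -
  define c where "c v = (if fst v = 0 then c0 (snd v) else if fst v = 1 then c1 (snd v)
    else if fst v = 2 then c2 (snd v) else c3 (snd v))" for v :: "nat \<times> nat"
  have c: "c (place 0 1 p) = case_sum c0 c1 p" "c (place 1 2 p) = case_sum c1 c2 p"
    "c (place 2 3 p) = case_sum c2 c3 p" "c (place 0 3 p) = case_sum c0 c3 p" for p
    by (cases p; simp add: c_def)+
  have step: "c v = c w" if "(v, w) \<in> layer 0 1 R \<union> layer 1 2 S \<union> layer 2 3 U" for v w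
    using that colour_R colour_S colour_U by (auto elim!: layer_cases simp: c simp del: One_nat_def)
  have *: "c v = c w" if "(v, w) \<in> (layer 0 1 R \<union> layer 1 2 S \<union> layer 2 3 U)\<^sup>*" for v w
    using that by (induction rule: rtrancl_induct) (simp_all only: step)
  show ?thesis
  proof (intro equalityI subrelI)
    fix p q assume "(p, q) \<in> R \<odot> S \<odot> U"
    then have "p \<in> outer R U" "q \<in> outer R U" "c (place 0 3 p) = c (place 0 3 q)"
      using * unfolding glue_glue_iff by blast+
    then show "(p, q) \<in> T"
      using colour_T by (simp only: c)
  next
    fix p q assume "(p, q) \<in> T"
    then show "(p, q) \<in> R \<odot> S \<odot> U"
      using outer path by (simp add: glue_glue_iff)
  qed
qed

section \<open>Transversals, rank and partial injections\<close>

text \<open>The transversals of a diagram, as a relation from the upper to the lower row.\<close>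

definition tr :: "(nat + nat) rel \<Rightarrow> nat rel" where
  "tr R = {(x, y). (Inl x, Inr y) \<in> R}"

text \<open>Blocks have at most two elements, so each block meeting both rows is counted once.\<close>

definition rk :: "(nat + nat) rel \<Rightarrow> nat" where
  "rk R = card (tr R)"

text \<open>Partial injections from \<open>{1..m}\<close> to \<open>{1..n}\<close>, represented by their graphs.\<close>

definition pinj :: "nat \<Rightarrow> nat \<Rightarrow> nat rel \<Rightarrow> bool" where
  "pinj m n f \<longleftrightarrow> f \<subseteq> {1..m} \<times> {1..n} \<and> single_valued f \<and> single_valued (f\<inverse>)"

text \<open>The diagram whose blocks of size two are the pairs \<open>{x, y'}\<close> with \<open>(x, y) \<in> f\<close>.\<close>

definition PI :: "nat \<Rightarrow> nat \<Rightarrow> nat rel \<Rightarrow> (nat + nat) rel" where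
  "PI m n f = Id_on (pts m n) \<union> {(Inl x, Inr y) | x y. (x, y) \<in> f} \<union> {(Inr y, Inl x) | x y. (x, y) \<in> f}"

lemma tr_iff [simp]: "(x, y) \<in> tr R \<longleftrightarrow> (Inl x, Inr y) \<in> R"
  by (simp add: tr_def)

lemma PI_iff [simp]:
  "(Inl x, Inl x') \<in> PI m n f \<longleftrightarrow> x = x' \<and> x \<in> {1..m}"
  "(Inr y, Inr y') \<in> PI m n f \<longleftrightarrow> y = y' \<and> y \<in> {1..n}"
  "(Inl x, Inr y) \<in> PI m n f \<longleftrightarrow> (x, y) \<in> f"
  "(Inr y, Inl x) \<in> PI m n f \<longleftrightarrow> (x, y) \<in> f"
  by (auto simp: PI_def Id_on_iff)

lemma tr_PI [simp]: "tr (PI m n f) = f"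
  by (auto simp: tr_def)

lemma pinjD:
  assumes "pinj m n f" "(x, y) \<in> f"
  shows "x \<in> {1..m}" "y \<in> {1..n}" "(x, y') \<in> f \<Longrightarrow> y' = y" "(x', y) \<in> f \<Longrightarrow> x' = x"
  using assms unfolding pinj_def by (auto dest: single_valuedD)

lemma pinjI:
  assumes "\<And>x y. (x, y) \<in> f \<Longrightarrow> x \<in> {1..m} \<and> y \<in> {1..n}"
    and "\<And>x y y'. (x, y) \<in> f \<Longrightarrow> (x, y') \<in> f \<Longrightarrow> y = y'"
    and "\<And>x x' y. (x, y) \<in> f \<Longrightarrow> (x', y) \<in> f \<Longrightarrow> x = x'"
  shows "pinj m n f"
  unfolding pinj_def using assms by (fastforce intro: single_valuedI)

lemma pinj_converse: "pinj m n f \<Longrightarrow> pinj n m (f\<inverse>)"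
  by (auto simp: pinj_def)

lemma pinj_relcomp: "pinj m n f \<Longrightarrow> pinj n k g \<Longrightarrow> pinj m k (f O g)"
  by (auto simp: pinj_def converse_relcomp single_valued_relcomp)

lemma pinj_Id_on: "A \<subseteq> {1..m} \<Longrightarrow> pinj m m (Id_on A)"
  by (auto intro!: pinjI)

lemma pinj_card:
  assumes "pinj m n f"
  shows "finite f" "card (Domain f) = card f" "card (Range f) = card f"
proof -
  show "finite f"
    using assms finite_subset by (fastforce simp: pinj_def)
  have "inj_on fst f" "inj_on snd f"
    using pinjD(3,4)[OF assms] by (auto simp: inj_on_def)
  then show "card (Domain f) = card f" "card (Range f) = card f"
    by (simp_all add: Domain_fst Range_snd card_image)
qed

lemma pinj_tr:
  assumes "R \<in> Hom m n"
  shows "pinj m n (tr R)"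
proof (rule pinjI)
  fix x y y' assume "(x, y) \<in> tr R" "(x, y') \<in> tr R"
  then show "y = y'"
    using Hom_le_2[OF assms, of "Inl x" "Inr y" "Inr y'"] by auto
next
  fix x x' y assume "(x, y) \<in> tr R" "(x', y) \<in> tr R"
  then show "x = x'"
    using Hom_le_2[OF assms, of "Inr y" "Inl x" "Inl x'"] Hom_sym[OF assms] by auto
qed (use Hom_pts[OF assms] in fastforce)

lemma PI_Hom:
  assumes "pinj m n f"
  shows "PI m n f \<in> Hom m n"
proof (rule HomI)
  fix p q assume "(p, q) \<in> PI m n f"
  then show "p \<in> pts m n" "(q, p) \<in> PI m n f"
    using pinjD(1,2)[OF assms] by (cases p; cases q; auto)+
  fix s assume "(q, s) \<in> PI m n f"
  then show "(p, s) \<in> PI m n f"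
    using \<open>(p, q) \<in> PI m n f\<close> pinjD(1,2)[OF assms]
    by (cases p; cases q; cases s; simp) (blast dest: pinjD(3,4)[OF assms])+
next
  fix p q q' assume "(p, q) \<in> PI m n f" "(p, q') \<in> PI m n f"
  then show "q = p \<or> q' = p \<or> q = q'"
    by (cases p; cases q; cases q'; simp) (blast dest: pinjD(3,4)[OF assms])+
qed (auto simp: PI_def Id_on_iff)

text \<open>If the block of \<open>x\<close> in \<open>R\<close> stays in the upper row, it is a whole component of every stacked diagram
  with top \<open>R\<close>.\<close>

lemma Domain_tr_glue:
  assumes "R \<in> Hom m n"
  shows "Domain (tr (R \<odot> S)) \<subseteq> Domain (tr R)"
proof (rule ccontr)
  assume "\<not> ?thesis"
  then obtain x y where xy: "(x, y) \<in> tr (R \<odot> S)" and x: "\<And>y. (Inl x, Inr y) \<notin> R"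
    by fastforce
  let ?C = "Pair 0 ` {x'. (Inl x, Inl x') \<in> R}"
  have closed: "w \<in> ?C" if v: "v \<in> ?C" and vw: "(v, w) \<in> layer 0 1 R \<union> layer 1 2 S" for v w
  proof -
    obtain x' where x': "v = (0, x')" "(Inl x, Inl x') \<in> R"
      using v by blast
    then have "(v, w) \<in> layer 0 1 R"
      using vw layer_levels[of v w 1 2 S] by auto
    then obtain q where "w = place 0 1 q" "(Inl x', q) \<in> R"
      using x' by (auto elim!: layer_cases simp: place_def split: sum.splits)
    then show ?thesis
      using x x' Hom_trans[OF assms, of "Inl x" "Inl x'" q] by (cases q) auto
  qed
  have "(place 0 2 (Inl x), place 0 2 (Inr y)) \<in> (layer 0 1 R \<union> layer 1 2 S)\<^sup>*"
    and "Inl x \<in> Field R"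
    using xy by (auto simp: glue_def)
  then have "place 0 2 (Inl x) \<in> ?C"
    using Hom_refl[OF assms] Field_Hom[OF assms] by auto
  have "place 0 2 (Inr y :: nat + nat) \<in> ?C"
    using \<open>(_, _) \<in> _\<^sup>*\<close> by (induction rule: rtrancl_induct) (fact, rule closed)
  then show False
    by auto
qed

lemma Range_tr_glue:
  assumes "S \<in> Hom n k"
  shows "Range (tr (R \<odot> S)) \<subseteq> Range (tr S)"
proof (rule ccontr)
  assume "\<not> ?thesis"
  then obtain x y where xy: "(x, y) \<in> tr (R \<odot> S)" and y: "\<And>x. (Inl x, Inr y) \<notin> S"
    by fastforce
  let ?C = "Pair 2 ` {y'. (Inr y', Inr y) \<in> S}"
  have closed: "v \<in> ?C" if w: "w \<in> ?C" and vw: "(v, w) \<in> layer 0 1 R \<union> layer 1 2 S" for v w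
  proof -
    obtain y' where y': "w = (2, y')" "(Inr y', Inr y) \<in> S"
      using w by blast
    then have "(v, w) \<in> layer 1 2 S"
      using vw layer_levels[of v w 0 1 R] by auto
    then obtain q where "v = place 1 2 q" "(q, Inr y') \<in> S"
      using y' by (auto elim!: layer_cases simp: place_def split: sum.splits)
    then show ?thesis
      using y y' Hom_trans[OF assms, of q "Inr y'" "Inr y"] by (cases q) auto
  qed
  have "(place 0 2 (Inl x), place 0 2 (Inr y)) \<in> (layer 0 1 R \<union> layer 1 2 S)\<^sup>*"
    and "Inr y \<in> Field S"
    using xy by (auto simp: glue_def)
  then have "place 0 2 (Inr y) \<in> ?C"
    using Hom_refl[OF assms] Field_Hom[OF assms] by auto
  have "place 0 2 (Inl x :: nat + nat) \<in> ?C"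
    using \<open>(_, _) \<in> _\<^sup>*\<close> by (induction rule: converse_rtrancl_induct) (fact, rule closed)
  then show False
    by auto
qed

lemma
  assumes "R \<in> Hom m n" "S \<in> Hom n k"
  shows rk_glue_le_left: "rk (R \<odot> S) \<le> rk R" and rk_glue_le_right: "rk (R \<odot> S) \<le> rk S"
proof -
  note c = pinj_card[OF pinj_tr]
  note RS = glue_Hom[OF assms]
  have "finite (Domain (tr R))" "finite (Range (tr S))"
    using c(1)[OF assms(1)] c(1)[OF assms(2)] by (simp_all add: finite_Domain finite_Range)
  then show "rk (R \<odot> S) \<le> rk R" "rk (R \<odot> S) \<le> rk S"
    unfolding rk_def using card_mono[OF _ Domain_tr_glue[OF assms(1)]]
      card_mono[OF _ Range_tr_glue[OF assms(2)]] c(2,3)[OF RS] c(2,3)[OF assms(1)] c(2,3)[OF assms(2)]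
    by metis+
qed

lemma rtrancl_edge:
  "(Inl x, Inl y) \<in> R \<Longrightarrow> layer a b R \<subseteq> G \<Longrightarrow> ((a, x), (a, y)) \<in> G\<^sup>*"
  "(Inl x, Inr y) \<in> R \<Longrightarrow> layer a b R \<subseteq> G \<Longrightarrow> ((a, x), (b, y)) \<in> G\<^sup>*"
  "(Inr x, Inl y) \<in> R \<Longrightarrow> layer a b R \<subseteq> G \<Longrightarrow> ((b, x), (a, y)) \<in> G\<^sup>*"
  "(Inr x, Inr y) \<in> R \<Longrightarrow> layer a b R \<subseteq> G \<Longrightarrow> ((b, x), (b, y)) \<in> G\<^sup>*"
  using layerI[of "Inl x" "Inl y" R a b] layerI[of "Inl x" "Inr y" R a b]
    layerI[of "Inr x" "Inl y" R a b] layerI[of "Inr x" "Inr y" R a b] by auto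

lemma Hom_class_eq: "R \<in> Hom m n \<Longrightarrow> (p, q) \<in> R \<Longrightarrow> R `` {p} = R `` {q}"
  by (auto dest: Hom_sym Hom_trans)

lemma Hom_class_eqD:
  assumes "R \<in> Hom m n" "R `` {p} = R `` {q}" "q \<in> pts m n"
  shows "(p, q) \<in> R"
  using Hom_refl[OF assms(1,3)] assms(2) by auto

text \<open>Every morphism is von Neumann regular, and its transversals run backwards are an inverse.\<close>

lemma glue_regular:
  assumes R: "R \<in> Hom m n"
  shows "R \<odot> PI n m ((tr R)\<inverse>) \<odot> R = R"
proof -
  \<comment> \<open>The colour of a point is its block in \<open>R\<close>, where the third level is coloured like the first and
    the second like the fourth.\<close>
  let ?I = "PI n m ((tr R)\<inverse>)"
  have class_sum: "case_sum (\<lambda>x. R `` {Inl x}) (\<lambda>y. R `` {Inr y}) p = R `` {p}" for p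
    by (cases p) auto
  show ?thesis
  proof (rule glue_glue_eqI[where ?c0.0 = "\<lambda>x. R `` {Inl x}" and ?c1.0 = "\<lambda>y. R `` {Inr y}"
        and ?c2.0 = "\<lambda>x. R `` {Inl x}" and ?c3.0 = "\<lambda>y. R `` {Inr y}"])
    fix p q assume "(p, q) \<in> ?I"
    then show "case_sum (\<lambda>y. R `` {Inr y}) (\<lambda>x. R `` {Inl x}) p =
        case_sum (\<lambda>y. R `` {Inr y}) (\<lambda>x. R `` {Inl x}) q"
      using Hom_class_eq[OF R] by (cases p; cases q) auto
  next
    fix p q assume pq: "(p, q) \<in> R"
    let ?G = "layer 0 1 R \<union> layer 1 2 ?I \<union> layer 2 3 R"
    have sub: "layer 0 1 R \<subseteq> ?G" "layer 1 2 ?I \<subseteq> ?G" "layer 2 3 R \<subseteq> ?G"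
      by auto
    have trans: "((0, x), (3, y)) \<in> ?G\<^sup>*" "((3, y), (0, x)) \<in> ?G\<^sup>*" if "(Inl x, Inr y) \<in> R" for x y
    proof -
      have yx: "(Inr y, Inl x) \<in> R" and yx': "(Inl y, Inr x) \<in> ?I" "(Inr x, Inl y) \<in> ?I"
        using that Hom_sym[OF R] by auto
      show "((0, x), (3, y)) \<in> ?G\<^sup>*"
        using rtrancl_edge(2)[OF that sub(1)] rtrancl_edge(2)[OF yx'(1) sub(2)]
          rtrancl_edge(2)[OF that sub(3)] by (meson rtrancl_trans)
      show "((3, y), (0, x)) \<in> ?G\<^sup>*"
        using rtrancl_edge(3)[OF yx sub(1)] rtrancl_edge(3)[OF yx'(2) sub(2)]
          rtrancl_edge(3)[OF yx sub(3)] by (meson rtrancl_trans)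
    qed
    show "(place 0 3 p, place 0 3 q) \<in> ?G\<^sup>*"
      using pq rtrancl_edge(1)[OF _ sub(1)] rtrancl_edge(4)[OF _ sub(3)] trans Hom_sym[OF R]
      by (cases p; cases q) auto
  qed (use R in \<open>auto simp: class_sum outer_Hom[OF R R] dest: Hom_pts Hom_class_eq Hom_class_eqD\<close>)
qed

text \<open>Between two partial injections that do not reach both ends of a block within one row, only the
  transversals of a diagram matter.\<close>

lemma PI_glue_PI:
  assumes g: "pinj k m g" and R: "R \<in> Hom m n" and h: "pinj n l h"
    and top: "\<And>y y'. y \<in> Range g \<Longrightarrow> y' \<in> Range g \<Longrightarrow> (Inl y, Inl y') \<in> R \<Longrightarrow> y = y'"
    and bot: "\<And>z z'. z \<in> Domain h \<Longrightarrow> z' \<in> Domain h \<Longrightarrow> (Inr z, Inr z') \<in> R \<Longrightarrow> z = z'"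
  shows "PI k m g \<odot> R \<odot> PI n l h = PI k l (g O tr R O h)"
proof -
  \<comment> \<open>Points are coloured by the block of \<open>R\<close> that they are attached to; the summand \<open>Inr\<close> provides
    private colours for the points that \<open>g\<close> and \<open>h\<close> leave isolated.\<close>
  define c0 :: "nat \<Rightarrow> (nat + nat) set + nat + nat"
    where "c0 x = (if x \<in> Domain g then Inl (R `` Inl ` (g `` {x})) else Inr (Inl x))" for x
  define c3 :: "nat \<Rightarrow> (nat + nat) set + nat + nat"
    where "c3 w = (if w \<in> Range h then Inl (R `` Inr ` (h\<inverse> `` {w})) else Inr (Inr w))" for w
  define c1 c2 :: "nat \<Rightarrow> (nat + nat) set + nat + nat"
    where "c1 y = Inl (R `` {Inl y})" and "c2 z = Inl (R `` {Inr z})" for y z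
  note c_defs = c0_def c1_def c2_def c3_def
  have g_img: "g `` {x} = {y}" if "(x, y) \<in> g" for x y
    using that pinjD[OF g] by auto
  have h_img: "h\<inverse> `` {w} = {z}" if "(z, w) \<in> h" for z w
    using that pinjD[OF h] by auto
  have c0: "c0 x = c1 y" if "(x, y) \<in> g" for x y
    using that by (auto simp: c_defs g_img)
  have c3: "c3 w = c2 z" if "(z, w) \<in> h" for z w
    using that by (auto simp: c_defs h_img)
  have c1: "(Inl y, q) \<in> R" if "c1 y = Inl (R `` {q})" "q \<in> pts m n" for y q
    using Hom_class_eqD[OF R] that by (simp add: c_defs)
  note gh = pinjD(1,2)[OF g] pinjD(1,2)[OF h]
  note outer = outer_Hom[OF PI_Hom[OF g] PI_Hom[OF h]]
  have fgh: "pinj k l (g O tr R O h)"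
    by (rule pinj_relcomp[OF g pinj_relcomp[OF pinj_tr[OF R] h]])
  let ?G = "layer 0 1 (PI k m g) \<union> layer 1 2 R \<union> layer 2 3 (PI n l h)"
  have sub: "layer 0 1 (PI k m g) \<subseteq> ?G" "layer 1 2 R \<subseteq> ?G" "layer 2 3 (PI n l h) \<subseteq> ?G"
    by auto
  have cross: "(x, w) \<in> g O tr R O h" if "c0 x = c3 w" for x w
  proof -
    have "x \<in> Domain g" "w \<in> Range h"
      using that by (auto simp: c_defs split: if_splits)
    then obtain y z where yz: "(x, y) \<in> g" "(z, w) \<in> h"
      by blast
    then have "(Inl y, Inr z) \<in> R"
      using that c0[OF yz(1)] c3[OF yz(2)] gh(3)[OF yz(2)] by (intro c1) (auto simp: c2_def)
    with yz show ?thesis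
      by (meson relcompI tr_iff)
  qed
  show ?thesis
  proof (rule glue_glue_eqI[of _ _ _ c0 c1 _ c2 c3])
    fix p q assume "(p, q) \<in> PI k m g"
    then show "case_sum c0 c1 p = case_sum c0 c1 q"
      using c0 by (cases p; cases q) auto
  next
    fix p q assume "(p, q) \<in> PI n l h"
    then show "case_sum c2 c3 p = case_sum c2 c3 q"
      using c3 by (cases p; cases q) auto
  next
    fix p q assume "(p, q) \<in> R"
    then show "case_sum c1 c2 p = case_sum c1 c2 q"
      using Hom_class_eq[OF R] by (cases p; cases q) (simp_all add: c_defs)
  next
    fix p q assume "(p, q) \<in> PI k l (g O tr R O h)"
    then show "p \<in> outer (PI k m g) (PI n l h) \<and> q \<in> outer (PI k m g) (PI n l h)"
      unfolding outer using Hom_pts[OF PI_Hom[OF fgh]] by blast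
  next
    fix p q assume "p \<in> outer (PI k m g) (PI n l h)" "q \<in> outer (PI k m g) (PI n l h)"
      and c: "case_sum c0 c3 p = case_sum c0 c3 q"
    then have pq: "p \<in> pts k l" "q \<in> pts k l"
      by (simp_all add: outer)
    have top': "x = x'" if "c0 x = c0 x'" for x x'
    proof (cases "x \<in> Domain g")
      case True
      moreover have "x' \<in> Domain g"
        using that True by (auto simp: c0_def split: if_splits)
      ultimately obtain y y' where yz: "(x, y) \<in> g" "(x', y') \<in> g"
        by blast
      then have "(Inl y, Inl y') \<in> R"
        using that c0[OF yz(1)] c0[OF yz(2)] gh(2)[OF yz(2)] by (intro c1) (auto simp: c1_def)
      then have "y = y'"
        using yz by (intro top) auto
      then show ?thesis
        using yz pinjD(4)[OF g] by blast
    qed (use that in \<open>auto simp: c0_def split: if_splits\<close>)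
    have bot': "w = w'" if "c3 w = c3 w'" for w w'
    proof (cases "w \<in> Range h")
      case True
      moreover have "w' \<in> Range h"
        using that True by (auto simp: c3_def split: if_splits)
      ultimately obtain z z' where yz: "(z, w) \<in> h" "(z', w') \<in> h"
        by blast
      then have "(Inr z, Inr z') \<in> R"
        using that c3[OF yz(1)] c3[OF yz(2)] gh(3)[OF yz(2)]
        by (intro Hom_class_eqD[OF R]) (auto simp: c2_def)
      then have "z = z'"
        using yz by (intro bot) auto
      then show ?thesis
        using yz pinjD(3)[OF h] by blast
    qed (use that in \<open>auto simp: c3_def split: if_splits\<close>)
    show "(p, q) \<in> PI k l (g O tr R O h)"
      using pq c top' bot' cross by (cases p; cases q) auto
  next
    have across: "((0, x), (3, w)) \<in> ?G\<^sup>*" "((3, w), (0, x)) \<in> ?G\<^sup>*"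
      if xw: "(x, w) \<in> g O tr R O h" for x w
    proof -
      obtain y z where *: "(x, y) \<in> g" "(Inl y, Inr z) \<in> R" "(z, w) \<in> h"
        using xw by auto
      then have e: "(Inl x, Inr y) \<in> PI k m g" "(Inr y, Inl x) \<in> PI k m g" "(Inr z, Inl y) \<in> R"
        "(Inl z, Inr w) \<in> PI n l h" "(Inr w, Inl z) \<in> PI n l h"
        using Hom_sym[OF R] by auto
      show "((0, x), (3, w)) \<in> ?G\<^sup>*"
        using rtrancl_edge(2)[OF e(1) sub(1)] rtrancl_edge(2)[OF *(2) sub(2)]
          rtrancl_edge(2)[OF e(4) sub(3)] by (meson rtrancl_trans)
      show "((3, w), (0, x)) \<in> ?G\<^sup>*"
        using rtrancl_edge(3)[OF e(2) sub(1)] rtrancl_edge(3)[OF e(3) sub(2)]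
          rtrancl_edge(3)[OF e(5) sub(3)] by (meson rtrancl_trans)
    qed
    fix p q assume "(p, q) \<in> PI k l (g O tr R O h)"
    then show "(place 0 3 p, place 0 3 q) \<in> ?G\<^sup>*"
      using across by (cases p; cases q; simp only: PI_iff place_simps; simp)
  qed
qed

abbreviation idm :: "nat \<Rightarrow> (nat + nat) rel" where
  "idm n \<equiv> PI n n (Id_on {1..n})"

lemma glue_idm_right:
  assumes R: "R \<in> Hom m n"
  shows "R \<odot> idm n = R"
proof (rule glue_eqI[where ?c0.0 = "\<lambda>x. R `` {Inl x}" and ?c1.0 = "\<lambda>y. R `` {Inr y}"
      and ?c2.0 = "\<lambda>y. R `` {Inr y}"])
  have class_sum: "case_sum (\<lambda>x. R `` {Inl x}) (\<lambda>y. R `` {Inr y}) p = R `` {p}" for p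
    by (cases p) auto
  note outer = outer_Hom[OF R PI_Hom[OF pinj_Id_on[OF order_refl]]]
  show "p \<in> outer R (idm n) \<and> q \<in> outer R (idm n)" if "(p, q) \<in> R" for p q
    using Hom_pts[OF R that] unfolding outer .
  show "case_sum (\<lambda>x. R `` {Inl x}) (\<lambda>y. R `` {Inr y}) p =
      case_sum (\<lambda>x. R `` {Inl x}) (\<lambda>y. R `` {Inr y}) q" if "(p, q) \<in> R" for p q
    unfolding class_sum by (rule Hom_class_eq[OF R that])
  show "case_sum (\<lambda>y. R `` {Inr y}) (\<lambda>y. R `` {Inr y}) p =
      case_sum (\<lambda>y. R `` {Inr y}) (\<lambda>y. R `` {Inr y}) q" if "(p, q) \<in> idm n" for p q
    using that by (cases p; cases q) auto
  show "(p, q) \<in> R" if "q \<in> outer R (idm n)"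
      "case_sum (\<lambda>x. R `` {Inl x}) (\<lambda>y. R `` {Inr y}) p =
      case_sum (\<lambda>x. R `` {Inl x}) (\<lambda>y. R `` {Inr y}) q" for p q
    using that unfolding class_sum outer by (rule Hom_class_eqD[OF R, rotated])
  fix p q assume pq: "(p, q) \<in> R"
  let ?G = "layer 0 1 R \<union> layer 1 2 (idm n)"
  have sub: "layer 0 1 R \<subseteq> ?G" "layer 1 2 (idm n) \<subseteq> ?G"
    by auto
  have down: "((1, y), (2, y)) \<in> ?G\<^sup>*" "((2, y), (1, y)) \<in> ?G\<^sup>*"
    if "y \<in> {1..n}" for y
    by (rule rtrancl_edge(2,3)[OF _ sub(2)], use that in \<open>simp add: Id_on_iff\<close>)+
  show "(place 0 2 p, place 0 2 q) \<in> ?G\<^sup>*"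
    using pq Hom_pts[OF R pq] down rtrancl_edge[OF _ sub(1)]
    by (cases p; cases q; simp) (blast intro: rtrancl_trans)+
qed

lemma glue_idm_left:
  assumes R: "R \<in> Hom m n"
  shows "idm m \<odot> R = R"
proof (rule glue_eqI[where ?c0.0 = "\<lambda>x. R `` {Inl x}" and ?c1.0 = "\<lambda>x. R `` {Inl x}"
      and ?c2.0 = "\<lambda>y. R `` {Inr y}"])
  have class_sum: "case_sum (\<lambda>x. R `` {Inl x}) (\<lambda>y. R `` {Inr y}) p = R `` {p}" for p
    by (cases p) auto
  note outer = outer_Hom[OF PI_Hom[OF pinj_Id_on[OF order_refl]] R]
  show "p \<in> outer (idm m) R \<and> q \<in> outer (idm m) R" if "(p, q) \<in> R" for p q
    using Hom_pts[OF R that] unfolding outer .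
  show "case_sum (\<lambda>x. R `` {Inl x}) (\<lambda>y. R `` {Inr y}) p =
      case_sum (\<lambda>x. R `` {Inl x}) (\<lambda>y. R `` {Inr y}) q" if "(p, q) \<in> R" for p q
    unfolding class_sum by (rule Hom_class_eq[OF R that])
  show "case_sum (\<lambda>x. R `` {Inl x}) (\<lambda>x. R `` {Inl x}) p =
      case_sum (\<lambda>x. R `` {Inl x}) (\<lambda>x. R `` {Inl x}) q" if "(p, q) \<in> idm m" for p q
    using that by (cases p; cases q) auto
  show "(p, q) \<in> R" if "q \<in> outer (idm m) R"
      "case_sum (\<lambda>x. R `` {Inl x}) (\<lambda>y. R `` {Inr y}) p =
      case_sum (\<lambda>x. R `` {Inl x}) (\<lambda>y. R `` {Inr y}) q" for p q
    using that unfolding class_sum outer by (rule Hom_class_eqD[OF R, rotated])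
  fix p q assume pq: "(p, q) \<in> R"
  let ?G = "layer 0 1 (idm m) \<union> layer 1 2 R"
  have sub: "layer 0 1 (idm m) \<subseteq> ?G" "layer 1 2 R \<subseteq> ?G"
    by auto
  have down: "((0, x), (1, x)) \<in> ?G\<^sup>*" "((1, x), (0, x)) \<in> ?G\<^sup>*"
    if "x \<in> {1..m}" for x
    by (rule rtrancl_edge(2,3)[OF _ sub(1)], use that in \<open>simp add: Id_on_iff\<close>)+
  show "(place 0 2 p, place 0 2 q) \<in> ?G\<^sup>*"
    using pq Hom_pts[OF R pq] down rtrancl_edge[OF _ sub(2)]
    by (cases p; cases q; simp) (blast intro: rtrancl_trans)+
qed

lemma PI_glue_PI_comp:
  assumes f: "pinj k m f" and g: "pinj m n g"
  shows "PI k m f \<odot> PI m n g = PI k n (f O g)"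
proof -
  have "PI k m f \<odot> PI m n g \<odot> idm n = PI k n (f O tr (PI m n g) O Id_on {1..n})"
    by (rule PI_glue_PI[OF f PI_Hom[OF g] pinj_Id_on]) auto
  also have "f O tr (PI m n g) O Id_on {1..n} = f O g"
  proof -
    have "g O Id_on {1..n} = g"
      using pinjD(2)[OF g] by fast
    then show ?thesis
      by simp
  qed
  finally show ?thesis
    unfolding glue_idm_right[OF glue_Hom[OF PI_Hom[OF f] PI_Hom[OF g]]] .
qed

section \<open>Idempotents of high rank\<close>

text \<open>A block of size two inside a row would leave at most \<open>r - 2\<close> points of that row to transversals.\<close>

lemma Hom_eq_PI:
  assumes R: "R \<in> Hom r r" and rank: "r \<le> rk R + 1"
  shows "R = PI r r (tr R)"
proof -
  note c = pinj_card[OF pinj_tr[OF R]]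
  have few: "a = b" if "X \<subseteq> {1..r}" "a \<in> {1..r} - X" "b \<in> {1..r} - X" "card X = card (tr R)" for X a b
  proof (rule ccontr)
    assume "a \<noteq> b"
    have "card (X \<union> {a, b}) \<le> r"
      using that card_mono[of "{1..r}" "X \<union> {a, b}"] by simp
    moreover have "card (X \<union> {a, b}) = card X + 2"
      using that \<open>a \<noteq> b\<close> finite_subset[OF that(1)] by (subst card_Un_disjoint) auto
    ultimately show False
      using rank that(4) by (simp add: rk_def)
  qed
  have top: "x = x'" if "(Inl x, Inl x') \<in> R" for x x'
  proof (rule ccontr)
    assume "x \<noteq> x'"
    then have "x \<notin> Domain (tr R)" "x' \<notin> Domain (tr R)"
      using Hom_le_2[OF R that, of "Inr _"] Hom_le_2[OF R Hom_sym[OF R that], of "Inr _"] by auto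
    moreover have "Domain (tr R) \<subseteq> {1..r}" "x \<in> {1..r}" "x' \<in> {1..r}"
      using pinjD(1)[OF pinj_tr[OF R]] Hom_pts[OF R that] by (blast, simp_all)
    ultimately show False
      using few[of "Domain (tr R)" x x'] c \<open>x \<noteq> x'\<close> by simp
  qed
  have bot: "y = y'" if "(Inr y, Inr y') \<in> R" for y y'
  proof (rule ccontr)
    assume "y \<noteq> y'"
    then have "(Inl x, Inr y) \<notin> R" "(Inl x, Inr y') \<notin> R" for x
      using Hom_le_2[OF R that, of "Inl x"] Hom_le_2[OF R Hom_sym[OF R that], of "Inl x"]
        Hom_sym[OF R, of "Inl x" "Inr y"] Hom_sym[OF R, of "Inl x" "Inr y'"] by auto
    then have "y \<notin> Range (tr R)" "y' \<notin> Range (tr R)"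
      by auto
    moreover have "Range (tr R) \<subseteq> {1..r}" "y \<in> {1..r}" "y' \<in> {1..r}"
      using pinjD(2)[OF pinj_tr[OF R]] Hom_pts[OF R that] by (blast, simp_all)
    ultimately show False
      using few[of "Range (tr R)" y y'] c \<open>y \<noteq> y'\<close> by simp
  qed
  have "(p, q) \<in> R \<longleftrightarrow> (p, q) \<in> PI r r (tr R)" for p q
  proof -
    have "(Inl x, Inl x') \<in> R \<longleftrightarrow> x = x' \<and> x \<in> {1..r}" for x x'
      using top[of x x'] Hom_pts[OF R, of "Inl x" "Inl x'"] Hom_refl[OF R, of "Inl x"] by auto
    moreover have "(Inr y, Inr y') \<in> R \<longleftrightarrow> y = y' \<and> y \<in> {1..r}" for y y'
      using bot[of y y'] Hom_pts[OF R, of "Inr y" "Inr y'"] Hom_refl[OF R, of "Inr y"] by auto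
    moreover have "(Inr y, Inl x) \<in> R \<longleftrightarrow> (Inl x, Inr y) \<in> R" for x y
      using Hom_sym[OF R] by blast
    ultimately show ?thesis
      by (cases p; cases q; simp)
  qed
  then show ?thesis
    by auto
qed

lemma idempotent_eq_PI_Id_on:
  assumes R: "R \<in> Hom r r" and idem: "R \<odot> R = R" and rank: "r \<le> rk R + 1"
  shows "\<exists>A \<subseteq> {1..r}. R = PI r r (Id_on A)"
proof -
  let ?f = "tr R"
  note eq = Hom_eq_PI[OF R rank]
  note f = pinj_tr[OF R]
  have "?f O ?f = ?f"
    using PI_glue_PI_comp[OF f f] idem eq by (metis tr_PI)
  have diag: "x = y" if xy: "(x, y) \<in> ?f" for x y
  proof -
    obtain z where z: "(x, z) \<in> ?f" "(z, y) \<in> ?f"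
      using xy \<open>?f O ?f = ?f\<close> by blast
    with xy show ?thesis
      using pinjD(3,4)[OF f] by blast
  qed
  have "?f = Id_on (Domain ?f)"
    by (auto dest: diag simp del: tr_iff)
  moreover have "Domain ?f \<subseteq> {1..r}"
    using pinjD(1)[OF f] by blast
  ultimately show ?thesis
    using eq by metis
qed

text \<open>All factors of a product have at least its rank, and partial identities are closed under
  products.\<close>

lemma generated_high_rank:
  assumes "R \<in> idempotent_generated (\<odot>) (Hom r r)"
  shows "R \<in> Hom r r" and "r \<le> rk R + 1 \<Longrightarrow> \<exists>A \<subseteq> {1..r}. R = PI r r (Id_on A)"
proof -
  have "R \<in> Hom r r \<and> (r \<le> rk R + 1 \<longrightarrow> (\<exists>A \<subseteq> {1..r}. R = PI r r (Id_on A)))"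
    using assms unfolding idempotent_generated_def
  proof induction
    case (gen R)
    then show ?case
      using idempotent_eq_PI_Id_on by (auto simp: idempotents_def)
  next
    case (mult R S)
    then have Hom: "R \<in> Hom r r" "S \<in> Hom r r"
      by auto
    show ?case
    proof (intro conjI impI glue_Hom[OF Hom])
      assume "r \<le> rk (R \<odot> S) + 1"
      then have "r \<le> rk R + 1" "r \<le> rk S + 1"
        using rk_glue_le_left[OF Hom] rk_glue_le_right[OF Hom] by linarith+
      then obtain A B where AB: "A \<subseteq> {1..r}" "B \<subseteq> {1..r}" "R = PI r r (Id_on A)" "S = PI r r (Id_on B)"
        using mult.IH by blast
      have "Id_on A O Id_on B = Id_on (A \<inter> B)"
        by auto
      then have "R \<odot> S = PI r r (Id_on (A \<inter> B))"
        using AB by (simp only: PI_glue_PI_comp[OF pinj_Id_on pinj_Id_on])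
      then show "\<exists>A \<subseteq> {1..r}. R \<odot> S = PI r r (Id_on A)"
        using AB by blast
    qed
  qed
  then show "R \<in> Hom r r" and "r \<le> rk R + 1 \<Longrightarrow> \<exists>A \<subseteq> {1..r}. R = PI r r (Id_on A)"
    by auto
qed

section \<open>Products of idempotents of low rank\<close>

text \<open>For distinct \<open>a\<close>, \<open>b\<close>, \<open>c\<close>, the idempotent with blocks \<open>{a, b'}\<close>, \<open>{b, c}\<close>, \<open>{a', c'}\<close> and
  \<open>{x, x'}\<close> for all other \<open>x\<close>.  It moves \<open>a\<close> to \<open>b\<close> at the cost of the auxiliary point \<open>c\<close>.  It is defined
  as the kernel of a colouring, which makes it an equivalence relation by construction: the first
  three blocks have the colours 0, 1, 2, and the block of \<open>x\<close> has the colour \<open>x + 3\<close>.\<close>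

definition swerve :: "nat \<Rightarrow> nat \<Rightarrow> nat \<Rightarrow> nat \<Rightarrow> (nat + nat) rel" where
  "swerve r a b c = {(p, q). p \<in> pts r r \<and> q \<in> pts r r \<and>
    (let col = case_sum (\<lambda>x. if x = a then 0 else if x = b \<or> x = c then 1 else x + 3)
                        (\<lambda>y. if y = b then 0 else if y = a \<or> y = c then 2 else y + 3)
     in col p = col q)}"

context
  fixes r a b c :: nat
  assumes abc: "a \<in> {1..r}" "b \<in> {1..r}" "c \<in> {1..r}" "a \<noteq> b" "a \<noteq> c" "b \<noteq> c"
begin

lemma swerve_iff:
  "(Inl x, Inl x') \<in> swerve r a b c \<longleftrightarrow> x \<in> {1..r} \<and> x' \<in> {1..r} \<and>
    (x = x' \<or> x = b \<and> x' = c \<or> x = c \<and> x' = b)"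
  "(Inr y, Inr y') \<in> swerve r a b c \<longleftrightarrow> y \<in> {1..r} \<and> y' \<in> {1..r} \<and>
    (y = y' \<or> y = a \<and> y' = c \<or> y = c \<and> y' = a)"
  "(Inl x, Inr y) \<in> swerve r a b c \<longleftrightarrow> x \<in> {1..r} \<and> y \<in> {1..r} \<and>
    (x = a \<and> y = b \<or> x = y \<and> x \<notin> {a, b, c})"
  "(Inr y, Inl x) \<in> swerve r a b c \<longleftrightarrow> x \<in> {1..r} \<and> y \<in> {1..r} \<and>
    (x = a \<and> y = b \<or> x = y \<and> x \<notin> {a, b, c})"
  using abc by (auto simp: swerve_def)

lemma swerve_Hom: "swerve r a b c \<in> Hom r r"
proof (rule HomI)
  fix p q q' assume "(p, q) \<in> swerve r a b c" "(p, q') \<in> swerve r a b c"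
  then show "q = p \<or> q' = p \<or> q = q'"
    using abc by (cases p; cases q; cases q'; simp only: swerve_iff sum.inject; blast)
qed (auto simp: swerve_def Let_def)

lemma tr_swerve: "tr (swerve r a b c) = insert (a, b) (Id_on ({1..r} - {a, b, c}))"
  using abc by (auto simp: swerve_iff Id_on_iff)

text \<open>In the stacked diagram, \<open>a\<close> and \<open>b'\<close> are joined by a path that zigzags through all three points
  \<open>b\<close>, \<open>c\<close>, \<open>a\<close> of the middle row.\<close>

lemma swerve_idem: "swerve r a b c \<odot> swerve r a b c = swerve r a b c" (is "?H \<odot> ?H = ?H")
proof -
  define k0 k1 k2 :: "nat \<Rightarrow> nat" where
    "k0 x = (if x = a then 0 else if x = b \<or> x = c then 1 else x + 3)" and
    "k1 x = (if x \<in> {a, b, c} then 0 else x + 3)" and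
    "k2 x = (if x = b then 0 else if x = a \<or> x = c then 2 else x + 3)" for x
  have k: "k0 a = 0" "k0 b = 1" "k0 c = 1" "k1 a = 0" "k1 b = 0" "k1 c = 0" "k2 a = 2" "k2 b = 0" "k2 c = 2"
    using abc by (simp_all add: k0_def k1_def k2_def)
  have k': "k0 x = x + 3" "k1 x = x + 3" "k2 x = x + 3" if "x \<notin> {a, b, c}" for x
    using that by (simp_all add: k0_def k1_def k2_def)
  show ?thesis
  proof (rule glue_eqI[where ?c0.0 = k0 and ?c1.0 = k1 and ?c2.0 = k2])
    note outer = outer_Hom[OF swerve_Hom swerve_Hom]
    show "p \<in> outer ?H ?H \<and> q \<in> outer ?H ?H" if "(p, q) \<in> ?H" for p q
      using Hom_pts[OF swerve_Hom that] unfolding outer .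
    fix p q assume pq: "(p, q) \<in> ?H"
    let ?G = "layer 0 1 ?H \<union> layer 1 2 ?H"
    have sub: "layer 0 1 ?H \<subseteq> ?G" "layer 1 2 ?H \<subseteq> ?G"
      by auto
    have H: "(Inl a, Inr b) \<in> ?H" "(Inr b, Inl a) \<in> ?H" "(Inl b, Inl c) \<in> ?H" "(Inl c, Inl b) \<in> ?H"
      "(Inr a, Inr c) \<in> ?H" "(Inr c, Inr a) \<in> ?H"
      using abc by (simp_all add: swerve_iff)
    have ab: "((0, a), (2, b)) \<in> ?G\<^sup>*"
      using rtrancl_edge(2)[OF H(1) sub(1)] rtrancl_edge(1)[OF H(3) sub(2)]
        rtrancl_edge(4)[OF H(6) sub(1)] rtrancl_edge(2)[OF H(1) sub(2)] by (meson rtrancl_trans)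
    have ba: "((2, b), (0, a)) \<in> ?G\<^sup>*"
      using rtrancl_edge(3)[OF H(2) sub(2)] rtrancl_edge(4)[OF H(5) sub(1)]
        rtrancl_edge(1)[OF H(4) sub(2)] rtrancl_edge(3)[OF H(2) sub(1)] by (meson rtrancl_trans)
    have straight: "((0, x), (2, x)) \<in> ?G\<^sup>*" "((2, x), (0, x)) \<in> ?G\<^sup>*" if "x \<in> {1..r} - {a, b, c}" for x
    proof -
      have *: "(Inl x, Inr x) \<in> ?H" "(Inr x, Inl x) \<in> ?H"
        using that by (simp_all add: swerve_iff)
      show "((0, x), (2, x)) \<in> ?G\<^sup>*"
        using rtrancl_edge(2)[OF *(1) sub(1)] rtrancl_edge(2)[OF *(1) sub(2)] by (meson rtrancl_trans)
      show "((2, x), (0, x)) \<in> ?G\<^sup>*"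
        using rtrancl_edge(3)[OF *(2) sub(1)] rtrancl_edge(3)[OF *(2) sub(2)] by (meson rtrancl_trans)
    qed
    have across: "x = a \<and> y = b \<or> x = y \<and> x \<in> {1..r} - {a, b, c}"
      if "(Inl x, Inr y) \<in> ?H \<or> (Inr y, Inl x) \<in> ?H" for x y
      using that by (auto simp: swerve_iff)
    show "(place 0 2 p, place 0 2 q) \<in> ?G\<^sup>*"
    proof (cases p; cases q)
      fix x x' assume "p = Inl x" "q = Inl x'"
      then show ?thesis
        using pq rtrancl_edge(1)[OF _ sub(1)] by (simp only: place_simps)
    next
      fix x y assume "p = Inl x" "q = Inr y"
      then show ?thesis
        using pq across[of x y] ab straight(1)[of x] by (simp only: place_simps) blast
    next
      fix x y assume "p = Inr y" "q = Inl x"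
      then show ?thesis
        using pq across[of x y] ba straight(2)[of x] by (simp only: place_simps) blast
    next
      fix y y' assume "p = Inr y" "q = Inr y'"
      then show ?thesis
        using pq rtrancl_edge(4)[OF _ sub(2)] by (simp only: place_simps)
    qed
  next
    fix p q assume pq: "(p, q) \<in> ?H"
    show "case_sum k0 k1 p = case_sum k0 k1 q"
      using pq by (cases p; cases q; simp only: swerve_iff sum.case; elim conjE disjE; simp add: k k')
    show "case_sum k1 k2 p = case_sum k1 k2 q"
      using pq by (cases p; cases q; simp only: swerve_iff sum.case; elim conjE disjE; simp add: k k')
  next
    fix p q assume "p \<in> outer ?H ?H" "q \<in> outer ?H ?H"
      and eq: "case_sum k0 k2 p = case_sum k0 k2 q"
    then have "p \<in> pts r r" "q \<in> pts r r"
      by (simp_all only: outer_Hom[OF swerve_Hom swerve_Hom])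
    then show "(p, q) \<in> ?H"
      using eq unfolding swerve_def k0_def[abs_def] k2_def[abs_def] by (simp add: Let_def)
  qed
qed

end

text \<open>The idempotent-generated part of the partial Brauer monoid of degree \<open>r\<close>.\<close>

abbreviation IG :: "nat \<Rightarrow> (nat + nat) rel set" where
  "IG r \<equiv> idempotent_generated (\<odot>) (Hom r r)"

lemma IG_idem: "R \<in> Hom r r \<Longrightarrow> R \<odot> R = R \<Longrightarrow> R \<in> IG r"
  by (auto simp: idempotent_generated_def idempotents_def intro: generated_subsemigroup.gen)

lemma IG_glue: "R \<in> IG r \<Longrightarrow> S \<in> IG r \<Longrightarrow> R \<odot> S \<in> IG r"
  by (auto simp: idempotent_generated_def intro: generated_subsemigroup.mult)

lemma IG_Id_on:
  assumes "A \<subseteq> {1..r}"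
  shows "PI r r (Id_on A) \<in> IG r"
proof (rule IG_idem)
  have "Id_on A O Id_on A = Id_on A"
    by auto
  then show "PI r r (Id_on A) \<odot> PI r r (Id_on A) = PI r r (Id_on A)"
    by (simp only: PI_glue_PI_comp[OF pinj_Id_on[OF assms] pinj_Id_on[OF assms]])
qed (rule PI_Hom[OF pinj_Id_on[OF assms]])

text \<open>Move a token from \<open>a\<close> to the free place \<open>b\<close>, with a further free place \<open>c\<close> and the other tokens
  resting on \<open>A\<close>: restrict \<open>swerve\<close> to partial identities that avoid its blocks within a row.\<close>

lemma IG_move:
  assumes A: "insert a A \<subseteq> {1..r}" "a \<notin> A" and b: "b \<in> {1..r}" "b \<notin> insert a A"
    and c: "c \<in> {1..r}" "c \<notin> insert b (insert a A)"
  shows "PI r r (insert (a, b) (Id_on A)) \<in> IG r"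
proof -
  have abc: "a \<in> {1..r}" "b \<in> {1..r}" "c \<in> {1..r}" "a \<noteq> b" "a \<noteq> c" "b \<noteq> c"
    using assms by auto
  let ?H = "swerve r a b c" and ?A = "Id_on (insert a A)" and ?B = "Id_on (insert b A)"
  note H = swerve_Hom[OF abc]
  have B: "insert b A \<subseteq> {1..r}"
    using A b by auto
  have "PI r r ?A \<odot> ?H \<odot> PI r r ?B = PI r r (?A O tr ?H O ?B)"
  proof (rule PI_glue_PI[OF pinj_Id_on[OF A(1)] H pinj_Id_on[OF B]])
    show "y = y'" if "y \<in> Range ?A" "y' \<in> Range ?A" "(Inl y, Inl y') \<in> ?H" for y y'
      using that b c by (auto simp: swerve_iff[OF abc])
    show "z = z'" if "z \<in> Domain ?B" "z' \<in> Domain ?B" "(Inr z, Inr z') \<in> ?H" for z z'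
      using that A b c by (auto simp: swerve_iff[OF abc])
  qed
  also have "?A O tr ?H O ?B = insert (a, b) (Id_on A)"
    unfolding tr_swerve[OF abc] using assms by (auto simp: Id_on_iff subset_iff relcomp_unfold)
  finally show ?thesis
    using IG_glue[OF IG_glue[OF IG_Id_on[OF A(1)] IG_idem[OF H swerve_idem[OF abc]]] IG_Id_on[OF B]]
    by simp
qed

text \<open>A partial injection \<open>f\<close> is a task of moving tokens, one on each point of its domain, to their
  targets.  With at least two free places it is a composition of moves of a single token to a free
  place, since a second free place is what \<open>swerve\<close> needs.  A token whose target is free goes there at
  once; if all targets are occupied, some misplaced token first makes room.\<close>

lemma PI_low_rank_generated:
  assumes "pinj r r f" "card f + 2 \<le> r"
  shows "PI r r f \<in> IG r"
  using assms
proof (induction "card {(x, y) \<in> f. x \<noteq> y}" arbitrary: f rule: less_induct)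
  case less
  let ?N = "\<lambda>f. {(x, y) \<in> f. x \<noteq> y} :: nat rel"
  \<comment> \<open>First move the token on \<open>a\<close> to the free place \<open>b\<close>, then continue from there.\<close>
  have exchange: "PI r r f \<in> IG r"
    if f: "pinj r r f" "card f + 2 \<le> r" and ad: "(a, d) \<in> f" and b: "b \<in> {1..r}" "b \<notin> Domain f"
      and g: "PI r r (insert (b, d) (f - {(a, d)})) \<in> IG r" for f a b d
  proof -
    let ?D = "Domain f" and ?g = "insert (b, d) (f - {(a, d)})"
    note c = pinj_card[OF f(1)]
    have "finite ?D" "?D \<subseteq> {1..r}"
      using c pinjD(1)[OF f(1)] by (auto simp: finite_Domain)
    then have "card (insert b ?D) < card {1..r}"
      using f(2) c b by simp
    then obtain e where e: "e \<in> {1..r}" "e \<notin> insert b ?D"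
      by (metis \<open>finite ?D\<close> card_mono finite_insert not_less subsetI)
    have D: "insert a (?D - {a}) = ?D"
      using ad by auto
    have move: "PI r r (insert (a, b) (Id_on (?D - {a}))) \<in> IG r"
      by (rule IG_move[of a _ r b e]) (use D b e \<open>?D \<subseteq> _\<close> in auto)
    have "(x, y) \<in> insert (a, b) (Id_on (?D - {a})) O ?g \<longleftrightarrow> (x, y) \<in> f" for x y
    proof (cases "x = a")
      case True
      have "(a, y) \<in> f \<longleftrightarrow> y = d"
        using ad pinjD(3)[OF f(1) ad] by blast
      then show ?thesis
        using True b by (auto simp: relcomp_unfold Id_on_iff)
    next
      case False
      then show ?thesis
        using ad b by (auto simp: relcomp_unfold Id_on_iff)
    qed
    then have "insert (a, b) (Id_on (?D - {a})) O ?g = f"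
      by (intro equalityI subrelI) (simp_all only:)
    moreover have "pinj r r ?g"
      using pinjD[OF f(1)] ad b by (intro pinjI) auto
    moreover have "pinj r r (insert (a, b) (Id_on (?D - {a})))"
      using \<open>?D \<subseteq> _\<close> b ad by (intro pinjI) (auto simp: Id_on_iff)
    ultimately show ?thesis
      using IG_glue[OF move g] PI_glue_PI_comp by metis
  qed
  have card_g: "card (insert (b, d) (f - {(a, d)})) = card f"
    if "pinj r r f" "(a, d) \<in> f" "b \<notin> Domain f" for f a b d
  proof -
    have "finite f"
      using pinj_card(1)[OF that(1)] .
    then have "card (insert (b, d) (f - {(a, d)})) = Suc (card (f - {(a, d)}))"
      using that(3) by (intro card_insert_disjoint) auto
    also have "\<dots> = card f"
      using \<open>finite f\<close> that(2) by (rule card_Suc_Diff1)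
    finally show ?thesis .
  qed
  have pinj_g: "pinj r r (insert (b, d) (f - {(a, d)}))"
    if "pinj r r f" "(a, d) \<in> f" "b \<notin> Domain f" "b \<in> {1..r}" for f a b d
    using pinjD[OF that(1)] that by (intro pinjI) auto
  have finite_N: "finite (?N f)" if "pinj r r f" for f
    using pinj_card(1)[OF that] by (rule rev_finite_subset) auto
  \<comment> \<open>If the target \<open>d\<close> is free, moving there reduces the number of misplaced tokens.\<close>
  have direct: "PI r r g \<in> IG r"
    if g: "pinj r r g" "card g + 2 \<le> r" "card (?N g) \<le> card (?N f)"
      and ad: "(a, d) \<in> g" "d \<notin> Domain g" for g a d
  proof (rule exchange[OF g(1,2) ad(1) _ ad(2)])
    show d: "d \<in> {1..r}"
      using pinjD(2)[OF g(1) ad(1)] .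
    let ?g = "insert (d, d) (g - {(a, d)})"
    have "?N ?g \<subset> ?N g"
      using ad by auto
    with finite_N[OF g(1)] have "card (?N ?g) < card (?N g)"
      by (rule psubset_card_mono)
    also note g(3)
    finally have "card (?N ?g) < card (?N f)" .
    then show "PI r r ?g \<in> IG r"
      using card_g[OF g(1) ad] pinj_g[OF g(1) ad d] g(2) by (intro less.hyps) auto
  qed
  note f = less.prems
  note c = pinj_card[OF f(1)]
  have D: "Domain f \<subseteq> {1..r}" "finite (Domain f)"
    using pinjD(1)[OF f(1)] c(1) by (auto simp: finite_Domain)
  consider (fixed) "\<And>x y. (x, y) \<in> f \<Longrightarrow> x = y" | (free) a d where "(a, d) \<in> f" "d \<notin> Domain f"
    | (blocked) a d where "(a, d) \<in> f" "a \<noteq> d" "Range f \<subseteq> Domain f"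
    by blast
  then show ?case
  proof cases
    case fixed
    then have "f = Id_on (Domain f)"
      by auto
    then show ?thesis
      using IG_Id_on[OF D(1)] by simp
  next
    case (free a d)
    then show ?thesis
      using direct[OF f] by blast
  next
    case (blocked a d)
    have "card (Domain f) < card {1..r}"
      using c f(2) by simp
    then obtain b where b: "b \<in> {1..r}" "b \<notin> Domain f"
      by (metis D(2) card_mono not_less subsetI)
    let ?g = "insert (b, d) (f - {(a, d)})"
    have "Range f = Domain f"
      using blocked(3) c D by (intro card_subset_eq) auto
    then obtain x where x: "(x, a) \<in> f"
      using blocked(1) by blast
    \<comment> \<open>Moving the token on \<open>a\<close> to \<open>b\<close> keeps it misplaced, but frees the target \<open>a\<close> of the token on \<open>x\<close>.\<close>
    show ?thesis
    proof (rule exchange[OF f blocked(1) b])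
      have "?N ?g \<subseteq> insert (b, d) (?N f - {(a, d)})"
        by auto
      then have "card (?N ?g) \<le> card (insert (b, d) (?N f - {(a, d)}))"
        using finite_N[OF f(1)] by (intro card_mono) auto
      also have "\<dots> \<le> Suc (card (?N f - {(a, d)}))"
        by (subst card_insert_if) (use finite_N[OF f(1)] in auto)
      also have "\<dots> = card (?N f)"
        using blocked finite_N[OF f(1)] by (intro card.remove[symmetric]) auto
      finally have le: "card (?N ?g) \<le> card (?N f)" .
      have "(x, a) \<in> ?g"
        using x blocked(2) by auto
      moreover have "a \<notin> Domain ?g"
        using blocked(1) b(2) pinjD(3)[OF f(1) blocked(1)] by blast
      ultimately show "PI r r ?g \<in> IG r"
        using pinj_g[OF f(1) blocked(1) b(2,1)] card_g[OF f(1) blocked(1) b(2)] f(2) le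
        by (intro direct) auto
    qed
  qed
qed

text \<open>With \<open>I\<close> the reversed transversals of \<open>R\<close>, write \<open>R\<close> as the product of the idempotent \<open>R \<odot> I\<close>, the
  transversals of \<open>R\<close> and the idempotent \<open>I \<odot> R\<close>.\<close>

lemma low_rank_generated:
  assumes R: "R \<in> Hom r r" and rank: "rk R + 2 \<le> r"
  shows "R \<in> IG r"
proof -
  let ?f = "tr R"
  let ?I = "PI r r (?f\<inverse>)"
  note f = pinj_tr[OF R]
  note f' = pinj_converse[OF f]
  note I = PI_Hom[OF f']
  have reg: "R \<odot> (?I \<odot> R) = R"
    using glue_regular[OF R] by (simp add: glue.assoc)
  have reg': "R \<odot> (?I \<odot> (R \<odot> X)) = R \<odot> X" for X
    using reg by (metis glue.assoc)
  have "R \<odot> ?I \<in> IG r" "?I \<odot> R \<in> IG r"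
    using glue_Hom[OF R I] glue_Hom[OF I R] by (auto intro!: IG_idem simp: glue.assoc reg reg')
  moreover have "PI r r ?f \<in> IG r"
    using PI_low_rank_generated[OF f] rank by (simp add: rk_def)
  moreover have "R \<odot> ?I \<odot> PI r r ?f \<odot> (?I \<odot> R) = R"
  proof -
    have "?f\<inverse> O ?f O ?f\<inverse> = ?f\<inverse>"
      using pinjD(3,4)[OF f] by (auto simp del: tr_iff)
    then have "?I \<odot> PI r r ?f \<odot> ?I = ?I"
      by (simp only: PI_glue_PI_comp[OF f' f] PI_glue_PI_comp[OF pinj_relcomp[OF f' f] f'] O_assoc)
    then have "?I \<odot> (PI r r ?f \<odot> (?I \<odot> R)) = ?I \<odot> R"
      by (metis glue.assoc)
    then show ?thesis
      using reg by (simp add: glue.assoc)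
  qed
  ultimately show ?thesis
    by (metis IG_glue)
qed

section \<open>The sandwich semigroup of relations\<close>

text \<open>Here \<open>P\<close> matches \<open>{1..r}\<close> with the upper ends of the transversals of \<open>s\<close>, and \<open>Q\<close> matches their
  lower ends with \<open>{1..r}\<close>, in such a way that \<open>Q \<odot> P\<close> consists of the reversed transversals.\<close>

lemma sandwich_factor:
  assumes s: "s \<in> Hom n m" and r: "r = rk s"
  obtains P Q where "P \<in> Hom r n" "Q \<in> Hom m r" "P \<odot> s \<odot> Q = idm r" "s \<odot> (Q \<odot> P) \<odot> s = s"
proof -
  let ?t = "tr s"
  note t = pinj_tr[OF s]
  have "finite (Domain ?t)" "card {1..r} = card (Domain ?t)"
    using pinj_card[OF t] r by (simp_all add: finite_Domain rk_def)
  then obtain e where e: "bij_betw e {1..r} (Domain ?t)"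
    using finite_same_card_bij by blast
  define u where "u = {(i, e i) | i. i \<in> {1..r}}"
  have u_iff: "(x, y) \<in> u \<longleftrightarrow> x \<in> {1..r} \<and> y = e x" for x y
    by (auto simp: u_def)
  have u: "pinj r n u"
  proof (rule pinjI)
    fix x y assume "(x, y) \<in> u"
    then have "x \<in> {1..r}" "y \<in> Domain ?t"
      using bij_betw_apply[OF e] by (simp_all only: u_iff)
    then show "x \<in> {1..r} \<and> y \<in> {1..n}"
      using pinjD(1)[OF t] by blast
  next
    fix x x' y assume "(x, y) \<in> u" "(x', y) \<in> u"
    then show "x = x'"
      using inj_onD[OF bij_betw_imp_inj_on[OF e], of x x'] by (simp only: u_iff)
  qed (simp only: u_iff)
  have u_dom: "Domain u = {1..r}" and u_ran: "Range u = Domain ?t"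
    unfolding bij_betw_imp_surj_on[OF e, symmetric] by (auto simp: u_iff image_iff)
  define v where "v = (u O ?t)\<inverse>"
  have v: "pinj m r v"
    unfolding v_def by (intro pinj_converse pinj_relcomp[OF u t])
  have v_dom: "Domain v \<subseteq> Range ?t"
    by (auto simp: v_def simp del: tr_iff)
  have "u O ?t O v = Id_on {1..r}"
  proof -
    have "Domain (u O ?t) = {1..r}"
      using u_dom u_ran by blast
    then have "(u O ?t) O (u O ?t)\<inverse> = Id_on {1..r}"
      using pinjD(4)[OF pinj_relcomp[OF u t]] by blast
    then show ?thesis
      by (simp add: v_def O_assoc)
  qed
  moreover have "PI r n u \<odot> s \<odot> PI m r v = PI r r (u O ?t O v)"
  proof (rule PI_glue_PI[OF u s v])
    fix y y' assume y: "y \<in> Range u" "(Inl y, Inl y') \<in> s"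
    then obtain z where "(Inl y, Inr z) \<in> s"
      using u_ran by auto
    then show "y = y'"
      using Hom_le_2[OF s y(2), of "Inr z"] by auto
  next
    fix z z' assume z: "z \<in> Domain v" "(Inr z, Inr z') \<in> s"
    then obtain y where "(Inl y, Inr z) \<in> s"
      using v_dom by auto
    then show "z = z'"
      using Hom_le_2[OF s z(2), of "Inl y"] Hom_sym[OF s] by auto
  qed
  ultimately have "PI r n u \<odot> s \<odot> PI m r v = idm r"
    by simp
  moreover have "PI m r v \<odot> PI r n u = PI m n (?t\<inverse>)"
  proof -
    have "v O u = ?t\<inverse>"
    proof -
      have "u\<inverse> O u = Id_on (Domain ?t)"
        using u_ran pinjD(3)[OF u] by blast
      moreover have "?t\<inverse> O Id_on (Domain ?t) = ?t\<inverse>"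
        by (auto simp del: tr_iff)
      ultimately show ?thesis
        by (simp add: v_def converse_relcomp O_assoc)
    qed
    then show ?thesis
      by (simp only: PI_glue_PI_comp[OF v u])
  qed
  ultimately show ?thesis
    using that[OF PI_Hom[OF u] PI_Hom[OF v]] glue_regular[OF s] by simp
qed

lemma rk_glue_le_middle:
  assumes "X \<in> Hom a b" "Y \<in> Hom b c" "Z \<in> Hom c d"
  shows "rk (X \<odot> Y \<odot> Z) \<le> rk Y"
  using rk_glue_le_left[OF glue_Hom[OF assms(1,2)] assms(3)] rk_glue_le_right[OF assms(1,2)] by simp

lemma idempotent_generated_relations:
  assumes s: "s \<in> Hom n m"
  defines "mul \<equiv> \<lambda>a b. a \<odot> s \<odot> b"
  defines "Reg \<equiv> regular_elements mul (Hom m n)"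
  shows "idempotent_generated mul (Hom m n) =
    idempotents mul {a \<in> Reg. rk a = rk s \<or> rk a + 1 = rk s} \<union> {a \<in> Reg. rk a + 2 \<le> rk s}"
proof -
  define r where "r = rk s"
  obtain P Q where P: "P \<in> Hom r n" and Q: "Q \<in> Hom m r" and PsQ: "P \<odot> s \<odot> Q = idm r"
    and sQPs: "s \<odot> (Q \<odot> P) \<odot> s = s"
    using sandwich_factor[OF s r_def] .
  note assoc = glue.assoc
  have sQPs': "s \<odot> (Q \<odot> (P \<odot> (s \<odot> x))) = s \<odot> x" for x
    using sQPs by (metis assoc)
  have PsQ': "P \<odot> (s \<odot> (Q \<odot> x)) = x" if "x \<in> Hom r k" for x k
    using PsQ glue_idm_left[OF that] by (metis assoc)
  define \<Phi> where "\<Phi> a = P \<odot> s \<odot> a \<odot> (s \<odot> Q)" for a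
  have Ps: "P \<odot> s \<in> Hom r m" and sQ: "s \<odot> Q \<in> Hom n r"
    using glue_Hom P Q s by blast+
  have \<Phi>_Hom: "\<Phi> a \<in> Hom r r" if "a \<in> Hom m n" for a
    unfolding \<Phi>_def by (intro glue_Hom[OF glue_Hom[OF Ps that] sQ])
  have \<Phi>_mul: "\<Phi> (mul a b) = \<Phi> a \<odot> \<Phi> b" for a b
    by (simp add: \<Phi>_def mul_def assoc sQPs')
  have mul_Hom: "mul a b \<in> Hom m n" if "a \<in> Hom m n" "b \<in> Hom m n" for a b
    unfolding mul_def using that glue_Hom s by blast
  have mul_assoc: "mul (mul a b) c = mul a (mul b c)" for a b c
    by (simp add: mul_def assoc)
  have s\<Phi>s: "s \<odot> (Q \<odot> (\<Phi> a \<odot> (P \<odot> (s \<odot> x)))) = s \<odot> (a \<odot> (s \<odot> x))" for a x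
    by (simp add: \<Phi>_def assoc sQPs')
  have Reg_Hom: "a \<in> Hom m n" if "a \<in> Reg" for a
    using that by (simp add: Reg_def regular_elements_def)
  have RegE: "\<exists>b \<in> Hom m n. mul a (mul b a) = a" if "a \<in> Reg" for a
    using that by (auto simp: Reg_def regular_elements_def mul_assoc)

  \<comment> \<open>With \<open>a = asbsa\<close>, \<open>a' = a'sb'sa'\<close> and \<open>p = asa' = pqp\<close>, the element \<open>b'sa'qasb\<close> is an inverse of \<open>p\<close>
    in the sandwich semigroup.\<close>
  have Reg_mul: "mul a a' \<in> Reg" if regular: "a \<in> Reg" "a' \<in> Reg" for a a'
  proof -
    obtain b b' where b: "b \<in> Hom m n" "mul a (mul b a) = a" and b': "b' \<in> Hom m n" "mul a' (mul b' a') = a'"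
      using RegE[OF regular(1)] RegE[OF regular(2)] by blast
    note Hom = Reg_Hom[OF regular(1)] Reg_Hom[OF regular(2)]
    let ?p = "mul a a'"
    have p: "?p \<in> Hom m n"
      using Hom by (rule mul_Hom)
    let ?q = "PI n m ((tr ?p)\<inverse>)"
    have q: "?q \<in> Hom n m"
      using pinj_converse[OF pinj_tr[OF p]] by (rule PI_Hom)
    let ?y = "mul b' (a' \<odot> ?q \<odot> mul a b)"
    have "a' \<odot> ?q \<odot> mul a b \<in> Hom m n"
      by (intro glue_Hom[OF glue_Hom[OF Hom(2) q]] mul_Hom Hom b)
    then have "?y \<in> Hom m n"
      by (intro mul_Hom b')
    moreover have "mul (mul ?p ?y) ?p = ?p"
    proof -
      have 1: "mul ?p (mul b' a') = ?p" "mul (mul a b) ?p = ?p"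
        using b(2) b'(2) by (metis mul_assoc)+
      have "mul (mul ?p ?y) ?p = mul ?p (mul b' a') \<odot> ?q \<odot> mul (mul a b) ?p"
        by (simp add: mul_def assoc)
      also have "\<dots> = ?p"
        unfolding 1 using glue_regular[OF p] .
      finally show ?thesis .
    qed
    ultimately show ?thesis
      using p by (auto simp: Reg_def regular_elements_def)
  qed

  have rk_Phi: "rk (\<Phi> a) = rk a" if regular: "a \<in> Reg" for a
  proof (rule antisym)
    obtain b where b: "b \<in> Hom m n" "mul a (mul b a) = a"
      using RegE[OF regular] by blast
    note a = Reg_Hom[OF regular]
    show "rk (\<Phi> a) \<le> rk a"
      unfolding \<Phi>_def by (rule rk_glue_le_middle[OF Ps a sQ])
    have "mul (mul a b) (mul a (mul b a)) = a"
      using b(2) by (metis mul_assoc)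
    then have "mul a b \<odot> (s \<odot> Q) \<odot> \<Phi> a \<odot> (P \<odot> s \<odot> mul b a) = a"
      by (simp add: mul_def assoc s\<Phi>s)
    then show "rk a \<le> rk (\<Phi> a)"
      using rk_glue_le_middle[OF glue_Hom[OF mul_Hom[OF a b(1)] sQ] \<Phi>_Hom[OF a]
        glue_Hom[OF Ps mul_Hom[OF b(1) a]]] by simp
  qed

  have rk_le: "rk a \<le> r" if regular: "a \<in> Reg" for a
  proof -
    obtain b where b: "b \<in> Hom m n" "mul a (mul b a) = a"
      using RegE[OF regular] by blast
    then show ?thesis
      using rk_glue_le_middle[OF Reg_Hom[OF regular] s mul_Hom[OF b(1) Reg_Hom[OF regular]]]
      by (simp add: mul_def r_def)
  qed

  have idem: "mul a a = a" if regular: "a \<in> Reg" and idem: "\<Phi> a \<odot> \<Phi> a = \<Phi> a" for a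
  proof -
    obtain b where b: "b \<in> Hom m n" "mul a (mul b a) = a"
      using RegE[OF regular] by blast
    have "s \<odot> (Q \<odot> (\<Phi> (mul a a) \<odot> (P \<odot> (s \<odot> x)))) = s \<odot> (Q \<odot> (\<Phi> a \<odot> (P \<odot> (s \<odot> x))))" for x
      by (simp add: \<Phi>_mul idem)
    then have saas: "s \<odot> (mul a a \<odot> (s \<odot> x)) = s \<odot> (a \<odot> (s \<odot> x))" for x
      by (simp only: s\<Phi>s)
    have "mul a a = mul (mul (mul a b) (mul a a)) (mul b a)"
      using b(2) by (metis mul_assoc)
    also have "\<dots> = mul (mul a b) (mul a (mul b a))"
      using saas[of "mul b a"] by (simp add: mul_def assoc)
    also have "\<dots> = a"
      using b(2) by (metis mul_assoc)
    finally show ?thesis .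
  qed

  have generated: "a \<in> Reg \<and> \<Phi> a \<in> IG r" if "a \<in> idempotent_generated mul (Hom m n)" for a
    using that unfolding idempotent_generated_def[of mul]
  proof induction
    case (gen a)
    then have a: "a \<in> Hom m n" "mul a a = a"
      by (auto simp: idempotents_def)
    then have "mul (mul a a) a = a"
      by simp
    with a(1) have "a \<in> Reg"
      unfolding Reg_def regular_elements_def by blast
    moreover have "\<Phi> a \<in> IG r"
    proof (rule IG_idem[OF \<Phi>_Hom[OF a(1)]])
      show "\<Phi> a \<odot> \<Phi> a = \<Phi> a"
        unfolding \<Phi>_mul[symmetric] a(2) ..
    qed
    ultimately show ?case ..
  next
    case (mult a b)
    then show ?case
      unfolding \<Phi>_mul using Reg_mul IG_glue by blast
  qed

  have idem_generated: "a \<in> idempotent_generated mul (Hom m n)" if "a \<in> Hom m n" "mul a a = a" for a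
    using that by (auto simp: idempotent_generated_def idempotents_def intro: generated_subsemigroup.gen)
  have mul_generated: "mul a b \<in> idempotent_generated mul (Hom m n)"
    if "a \<in> idempotent_generated mul (Hom m n)" "b \<in> idempotent_generated mul (Hom m n)" for a b
    using that by (auto simp: idempotent_generated_def intro: generated_subsemigroup.mult)

  have lift: "Q \<odot> x \<odot> P \<in> idempotent_generated mul (Hom m n)" if "x \<in> IG r" for x
    using that unfolding idempotent_generated_def[of glue]
  proof induction
    case (gen x)
    then have x: "x \<in> Hom r r" "x \<odot> x = x"
      by (auto simp: idempotents_def)
    have "mul (Q \<odot> x \<odot> P) (Q \<odot> x \<odot> P) = Q \<odot> (x \<odot> x) \<odot> P"
      by (simp add: mul_def assoc PsQ'[OF glue_Hom[OF x(1) P]])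
    then show ?case
      using x glue_Hom[OF glue_Hom[OF Q x(1)] P] by (intro idem_generated) auto
  next
    case (mult x y)
    then have "y \<in> Hom r r"
      using generated_high_rank(1) by (auto simp: idempotent_generated_def)
    then have "mul (Q \<odot> x \<odot> P) (Q \<odot> y \<odot> P) = Q \<odot> (x \<odot> y) \<odot> P"
      by (simp add: mul_def assoc PsQ'[OF glue_Hom[OF _ P]])
    then show ?case
      using mul_generated mult.IH by metis
  qed

  show ?thesis
  proof (intro equalityI subsetI)
    fix a assume "a \<in> idempotent_generated mul (Hom m n)"
    then have a: "a \<in> Reg" "\<Phi> a \<in> IG r"
      using generated by auto
    show "a \<in> idempotents mul {a \<in> Reg. rk a = rk s \<or> rk a + 1 = rk s} \<union> {a \<in> Reg. rk a + 2 \<le> rk s}"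
    proof (cases "r \<le> rk a + 1")
      case True
      then obtain A where A: "A \<subseteq> {1..r}" "\<Phi> a = PI r r (Id_on A)"
        using generated_high_rank(2)[OF a(2)] rk_Phi[OF a(1)] by auto
      have "Id_on A O Id_on A = Id_on A"
        by auto
      then have "\<Phi> a \<odot> \<Phi> a = \<Phi> a"
        unfolding A(2) by (simp only: PI_glue_PI_comp[OF pinj_Id_on[OF A(1)] pinj_Id_on[OF A(1)]])
      moreover have "rk a = rk s \<or> rk a + 1 = rk s"
        using True rk_le[OF a(1)] by (auto simp: r_def)
      ultimately show ?thesis
        using a idem by (simp add: idempotents_def)
    next
      case False
      then show ?thesis
        using a by (simp add: r_def)
    qed
  next
    fix a assume "a \<in> idempotents mul {a \<in> Reg. rk a = rk s \<or> rk a + 1 = rk s} \<union> {a \<in> Reg. rk a + 2 \<le> rk s}"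
    then consider "a \<in> Reg" "mul a a = a" | "a \<in> Reg" "rk a + 2 \<le> r"
      by (auto simp: idempotents_def r_def)
    then show "a \<in> idempotent_generated mul (Hom m n)"
    proof cases
      case 1
      then show ?thesis
        using Reg_Hom idem_generated by blast
    next
      case 2
      obtain b where b: "b \<in> Hom m n" "mul a (mul b a) = a"
        using RegE[OF 2(1)] by blast
      note a = Reg_Hom[OF 2(1)]
      have "\<Phi> a \<in> IG r"
        using low_rank_generated[OF \<Phi>_Hom[OF a]] 2 rk_Phi by simp
      then have "Q \<odot> \<Phi> a \<odot> P \<in> idempotent_generated mul (Hom m n)"
        by (rule lift)
      moreover have "mul a b \<in> idempotent_generated mul (Hom m n)"
        "mul b a \<in> idempotent_generated mul (Hom m n)"
        using a b by (intro idem_generated mul_Hom; metis mul_assoc)+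
      moreover have "mul (mul (mul a b) (Q \<odot> \<Phi> a \<odot> P)) (mul b a) = a"
      proof -
        have "mul (mul (mul a b) (Q \<odot> \<Phi> a \<odot> P)) (mul b a) = mul (mul a b) (mul a (mul b a))"
          by (simp add: mul_def assoc s\<Phi>s)
        also have "\<dots> = a"
          using b(2) by (metis mul_assoc)
        finally show ?thesis .
      qed
      ultimately show ?thesis
        using mul_generated by metis
    qed
  qed
qed

section \<open>From relations back to partitions\<close>

abbreviation vx :: "nat + nat \<Rightarrow> vertex" where
  "vx \<equiv> case_sum Plain Primed"

text \<open>The equivalence relation of a partition, transported to two-row points.  Vertices \<open>DPrimed x\<close>
  are ignored; they do not occur in partial Brauer partitions.\<close>

definition rel_of :: "vertex set set \<Rightarrow> (nat + nat) rel" where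
  "rel_of \<alpha> = {(p, q). (vx p, vx q) \<in> block_edges \<alpha>}"

text \<open>The set of classes of \<open>R\<close>, as a partition of vertices; inverse to \<open>rel_of\<close>.\<close>

definition part_of :: "nat \<Rightarrow> nat \<Rightarrow> (nat + nat) rel \<Rightarrow> vertex set set" where
  "part_of m n R = verts m n // (map_prod vx vx ` R)"

lemma vx_inject [simp]: "vx p = vx q \<longleftrightarrow> p = q"
  by (cases p; cases q) auto

lemma vx_in_verts [simp]: "vx p \<in> verts m n \<longleftrightarrow> p \<in> pts m n"
  by (cases p) (auto simp: verts_def)

lemma verts_eq: "verts m n = vx ` pts m n"
  unfolding verts_def pts_def Plus_def by (simp add: image_Un image_image)

lemma image_vx_iff [simp]: "(vx p, vx q) \<in> map_prod vx vx ` R \<longleftrightarrow> (p, q) \<in> R"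
  by (force simp: image_iff)

lemma equiv_image_vx:
  assumes "R \<in> Hom m n"
  shows "equiv (verts m n) (map_prod vx vx ` R)"
proof (intro equivI refl_onI symI transI)
  show "map_prod vx vx ` R \<subseteq> verts m n \<times> verts m n"
    using Hom_pts[OF assms] by auto
  show "(v, v) \<in> map_prod vx vx ` R" if "v \<in> verts m n" for v
    using that Hom_refl[OF assms] by (auto simp: verts_eq)
  show "(w, v) \<in> map_prod vx vx ` R" if "(v, w) \<in> map_prod vx vx ` R" for v w
    using that Hom_sym[OF assms] by auto
  show "(u, w) \<in> map_prod vx vx ` R"
    if "(u, v) \<in> map_prod vx vx ` R" "(v, w) \<in> map_prod vx vx ` R" for u v w
    using that Hom_trans[OF assms] by auto
qed

text \<open>A formulation of the bound on block sizes that matches the definition of \<open>Hom\<close>.\<close>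

lemma card_1_2_iff:
  assumes "finite B"
  shows "card B = 1 \<or> card B = 2 \<longleftrightarrow> B \<noteq> {} \<and> (\<forall>x\<in>B. \<forall>y\<in>B. \<forall>z\<in>B. y = x \<or> z = x \<or> y = z)"
proof
  assume "card B = 1 \<or> card B = 2"
  then show "B \<noteq> {} \<and> (\<forall>x\<in>B. \<forall>y\<in>B. \<forall>z\<in>B. y = x \<or> z = x \<or> y = z)"
    by (auto simp: card_1_singleton_iff card_2_iff)
next
  assume B: "B \<noteq> {} \<and> (\<forall>x\<in>B. \<forall>y\<in>B. \<forall>z\<in>B. y = x \<or> z = x \<or> y = z)"
  then obtain x where x: "x \<in> B"
    by blast
  show "card B = 1 \<or> card B = 2"
  proof (cases "B = {x}")
    case False
    then obtain y where y: "y \<in> B" "y \<noteq> x"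
      using x by blast
    then have "B = {x, y}"
      using B x by blast
    then show ?thesis
      using y by simp
  qed simp
qed

lemma block_edges_eq: "block_edges \<alpha> = {(x, y). \<exists>B\<in>\<alpha>. x \<in> B \<and> y \<in> B}"
  by (auto simp: block_edges_def)

lemma finite_verts: "finite (verts m n)"
  by (simp add: verts_def)

context
  fixes m n :: nat and \<alpha> :: "vertex set set"
  assumes PB: "\<alpha> \<in> PB m n"
begin

lemma PB_partition: "partition_on (verts m n) \<alpha>"
  using PB by (simp add: PB_def)

lemma PB_block: "B \<in> \<alpha> \<Longrightarrow> x \<in> B \<Longrightarrow> y \<in> B \<Longrightarrow> z \<in> B \<Longrightarrow> y = x \<or> z = x \<or> y = z"
proof -
  assume B: "B \<in> \<alpha>" and xyz: "x \<in> B" "y \<in> B" "z \<in> B"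
  have "finite B"
    using B partition_onD1[OF PB_partition] finite_verts by (metis Sup_upper finite_subset)
  moreover have "card B = 1 \<or> card B = 2"
    using B PB by (simp add: PB_def)
  ultimately have "\<forall>x\<in>B. \<forall>y\<in>B. \<forall>z\<in>B. y = x \<or> z = x \<or> y = z"
    using card_1_2_iff by blast
  with xyz show ?thesis
    by blast
qed

lemma equiv_block_edges: "equiv (verts m n) (block_edges \<alpha>)"
  unfolding block_edges_eq by (rule equiv_partition_on[OF PB_partition])

lemma block_edges_image: "block_edges \<alpha> = map_prod vx vx ` rel_of \<alpha>"
proof (intro equalityI subrelI)
  fix v w assume vw: "(v, w) \<in> block_edges \<alpha>"
  then have "v \<in> verts m n" "w \<in> verts m n"
    using equiv_block_edges by (auto elim!: equivE)
  then obtain p q where "v = vx p" "w = vx q"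
    by (auto simp: verts_eq)
  with vw show "(v, w) \<in> map_prod vx vx ` rel_of \<alpha>"
    by (simp add: rel_of_def)
qed (auto simp: rel_of_def)

lemma part_of_rel_of: "part_of m n (rel_of \<alpha>) = \<alpha>"
  unfolding part_of_def block_edges_image[symmetric] block_edges_eq
  by (rule partition_on_eq_quotient[OF PB_partition])

lemma rel_of_Hom: "rel_of \<alpha> \<in> Hom m n"
proof (rule HomI)
  note e = equiv_block_edges
  show "p \<in> pts m n" if "(p, q) \<in> rel_of \<alpha>" for p q
    using that e vx_in_verts by (fastforce simp: rel_of_def elim!: equivE)
  show "(p, p) \<in> rel_of \<alpha>" if "p \<in> pts m n" for p
    using that refl_onD[of "verts m n" "block_edges \<alpha>" "vx p"] e by (simp add: rel_of_def equiv_def)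
  show "(q, p) \<in> rel_of \<alpha>" if "(p, q) \<in> rel_of \<alpha>" for p q
    using that by (auto simp: rel_of_def block_edges_eq)
  show "(p, s) \<in> rel_of \<alpha>" if "(p, q) \<in> rel_of \<alpha>" "(q, s) \<in> rel_of \<alpha>" for p q s
    using that e by (auto simp: rel_of_def elim!: equivE dest: transD)
  fix p q q' assume pq: "(p, q) \<in> rel_of \<alpha>" "(p, q') \<in> rel_of \<alpha>"
  then obtain B B' where "B \<in> \<alpha>" "vx p \<in> B" "vx q \<in> B" "B' \<in> \<alpha>" "vx p \<in> B'" "vx q' \<in> B'"
    by (auto simp: rel_of_def block_edges_eq)
  moreover from this have "B = B'"
    using partition_onD2[OF PB_partition] by (auto simp: disjoint_def)
  ultimately have "vx q = vx p \<or> vx q' = vx p \<or> vx q = vx q'"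
    using PB_block by blast
  then show "q = p \<or> q' = p \<or> q = q'"
    by simp
qed

lemma pb_rank_eq_rk: "pb_rank \<alpha> = rk (rel_of \<alpha>)"
proof -
  let ?T = "{B \<in> \<alpha>. B \<inter> range Plain \<noteq> {} \<and> B \<inter> range Primed \<noteq> {}}"
  let ?g = "\<lambda>(x, y). {Plain x, Primed y}"
  have block: "B = {Plain x, Primed y}" if "B \<in> \<alpha>" "Plain x \<in> B" "Primed y \<in> B" for B x y
    using PB_block[OF that(1,2,3)] that by blast
  have "?g ` tr (rel_of \<alpha>) = ?T"
  proof (intro equalityI subsetI)
    fix B assume "B \<in> ?g ` tr (rel_of \<alpha>)"
    then obtain x y where xy: "(Inl x, Inr y) \<in> rel_of \<alpha>" "B = {Plain x, Primed y}"
      by auto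
    then obtain B' where "B' \<in> \<alpha>" "Plain x \<in> B'" "Primed y \<in> B'"
      by (auto simp: rel_of_def block_edges_eq)
    with block[OF this] xy show "B \<in> ?T"
      by auto
  next
    fix B assume "B \<in> ?T"
    then obtain x y where B: "B \<in> \<alpha>" "Plain x \<in> B" "Primed y \<in> B"
      by auto
    then have "(x, y) \<in> tr (rel_of \<alpha>)"
      by (auto simp: rel_of_def block_edges_eq)
    with block[OF B] show "B \<in> ?g ` tr (rel_of \<alpha>)"
      by (intro image_eqI[of _ _ "(x, y)"]) auto
  qed
  moreover have "inj_on ?g (tr (rel_of \<alpha>))"
    by (auto simp: inj_on_def doubleton_eq_iff)
  ultimately show ?thesis
    unfolding pb_rank_def rk_def using card_image by fastforce
qed

end

lemma part_of_PB:
  assumes R: "R \<in> Hom m n"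
  shows "part_of m n R \<in> PB m n"
proof -
  let ?E = "map_prod vx vx ` R"
  have "card B = 1 \<or> card B = 2" if "B \<in> part_of m n R" for B
  proof -
    obtain p where p: "p \<in> pts m n" "B = ?E `` {vx p}"
      using \<open>B \<in> _\<close> by (auto simp: part_of_def verts_eq quotient_def)
    then have B: "B = vx ` (R `` {p})"
      by (auto simp: image_iff)
    have "finite (R `` {p})"
      by (rule finite_subset[OF _ finite_pts[of m n]]) (auto dest: Hom_pts[OF R])
    then have "finite B"
      by (simp add: B)
    moreover have "y = x \<or> z = x \<or> y = z" if "x \<in> B" "y \<in> B" "z \<in> B" for x y z
    proof -
      obtain a b c where "x = vx a" "y = vx b" "z = vx c" "(p, a) \<in> R" "(p, b) \<in> R" "(p, c) \<in> R"
        using \<open>x \<in> B\<close> \<open>y \<in> B\<close> \<open>z \<in> B\<close> by (auto simp: B)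
      moreover from this have "(a, b) \<in> R" "(a, c) \<in> R"
        using Hom_sym[OF R] Hom_trans[OF R] by blast+
      ultimately show ?thesis
        using Hom_le_2[OF R, of a b c] by auto
    qed
    moreover have "B \<noteq> {}"
      using p Hom_refl[OF R] by (auto simp: B)
    ultimately show ?thesis
      by (subst card_1_2_iff) blast+
  qed
  moreover have "partition_on (verts m n) (part_of m n R)"
    unfolding part_of_def by (rule partition_on_quotient[OF equiv_image_vx[OF R]])
  ultimately show ?thesis
    by (simp add: PB_def)
qed

lemma rel_of_part_of:
  assumes R: "R \<in> Hom m n"
  shows "rel_of (part_of m n R) = R"
proof -
  note e = equiv_image_vx[OF R]
  have "block_edges (part_of m n R) = map_prod vx vx ` R"
  proof (intro equalityI subrelI)
    fix v w assume "(v, w) \<in> block_edges (part_of m n R)"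
    then obtain B where "B \<in> part_of m n R" "v \<in> B" "w \<in> B"
      unfolding block_edges_eq by blast
    then show "(v, w) \<in> map_prod vx vx ` R"
      unfolding part_of_def by (intro in_quotient_imp_in_rel[OF e, of B]) simp_all
  next
    fix v w assume vw: "(v, w) \<in> map_prod vx vx ` R"
    then have "v \<in> verts m n"
      using e by (auto elim!: equivE)
    then have "(map_prod vx vx ` R) `` {v} \<in> part_of m n R" "v \<in> (map_prod vx vx ` R) `` {v}"
      unfolding part_of_def by (rule quotientI, rule equiv_class_self[OF e])
    with vw have "\<exists>B\<in>part_of m n R. v \<in> B \<and> w \<in> B"
      by (intro bexI[of _ "(map_prod vx vx ` R) `` {v}"]) (simp_all only: Image_singleton_iff)
    then show "(v, w) \<in> block_edges (part_of m n R)"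
      by (simp add: block_edges_eq)
  qed
  then show ?thesis
    by (auto simp: rel_of_def)
qed

text \<open>The vertices of the product graph, placed on three levels: \<open>DPrimed\<close> vertices are in the middle.\<close>

definition level :: "vertex \<Rightarrow> nat \<times> nat" where
  "level v = (case v of Plain x \<Rightarrow> (0, x) | DPrimed x \<Rightarrow> (1, x) | Primed x \<Rightarrow> (2, x))"

lemma inj_level: "inj level"
  by (auto simp: inj_on_def level_def split: vertex.splits)

lemma level_vx [simp]:
  "level (vx p) = place 0 2 p"
  "level (lower_to_mid (vx p)) = place 0 1 p"
  "level (upper_to_mid (vx p)) = place 1 2 p"
  by (cases p; simp add: level_def)+

lemma block_edges_map: "block_edges ((`) f ` \<alpha>) = map_prod f f ` block_edges \<alpha>"
  unfolding block_edges_def by (force simp: image_iff)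

lemma level_product_graph:
  assumes "\<alpha> \<in> PB m n" "\<beta> \<in> PB n k"
  shows "map_prod level level ` product_graph \<alpha> \<beta> = layer 0 1 (rel_of \<alpha>) \<union> layer 1 2 (rel_of \<beta>)"
proof -
  have "level \<circ> lower_to_mid \<circ> vx = place 0 1" "level \<circ> upper_to_mid \<circ> vx = place 1 2"
    by (simp_all add: fun_eq_iff)
  then show ?thesis
    by (simp add: product_graph_def layer_def block_edges_map image_Un image_comp
        block_edges_image[OF assms(1)] block_edges_image[OF assms(2)] o_assoc flip: map_prod_compose)
qed

lemma pb_prod_eq:
  assumes "\<alpha> \<in> PB m n" "\<beta> \<in> PB n k"
  shows "pb_prod m k \<alpha> \<beta> = part_of m k (rel_of \<alpha> \<odot> rel_of \<beta>)"
proof -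
  have "(vx p, vx q) \<in> (product_graph \<alpha> \<beta>)\<^sup>* \<longleftrightarrow>
      (place 0 2 p, place 0 2 q) \<in> (layer 0 1 (rel_of \<alpha>) \<union> layer 1 2 (rel_of \<beta>))\<^sup>*" for p q
    using rtrancl_inj_image_iff[OF inj_level, of "vx p" "vx q" "product_graph \<alpha> \<beta>"]
    by (simp only: level_product_graph[OF assms] level_vx)
  then have "{(x, y). x \<in> verts m k \<and> y \<in> verts m k \<and> (x, y) \<in> (product_graph \<alpha> \<beta>)\<^sup>*} =
      map_prod vx vx ` (rel_of \<alpha> \<odot> rel_of \<beta>)"
    unfolding glue_def outer_Hom[OF rel_of_Hom[OF assms(1)] rel_of_Hom[OF assms(2)]] verts_eq
    by (auto simp: image_iff)
  then show ?thesis
    by (simp add: pb_prod_def part_of_def)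
qed

lemma
  assumes "\<alpha> \<in> PB m n" "\<beta> \<in> PB n k"
  shows pb_prod_PB: "pb_prod m k \<alpha> \<beta> \<in> PB m k"
    and rel_of_pb_prod: "rel_of (pb_prod m k \<alpha> \<beta>) = rel_of \<alpha> \<odot> rel_of \<beta>"
proof -
  have "rel_of \<alpha> \<odot> rel_of \<beta> \<in> Hom m k"
    using glue_Hom rel_of_Hom assms by blast
  then show "pb_prod m k \<alpha> \<beta> \<in> PB m k" "rel_of (pb_prod m k \<alpha> \<beta>) = rel_of \<alpha> \<odot> rel_of \<beta>"
    unfolding pb_prod_eq[OF assms] by (rule part_of_PB, rule rel_of_part_of)
qed

lemma bij_betw_rel_of: "bij_betw rel_of (PB m n) (Hom m n)"
  by (rule bij_betw_byWitness[of _ "part_of m n"])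
    (auto simp: part_of_rel_of rel_of_part_of rel_of_Hom part_of_PB)

text \<open>Idempotents, regular elements and generated subsemigroups are transported by injective
  homomorphisms.\<close>

context
  fixes \<phi> :: "'a \<Rightarrow> 'b" and S :: "'a set" and mul :: "'a \<Rightarrow> 'a \<Rightarrow> 'a" and mul' :: "'b \<Rightarrow> 'b \<Rightarrow> 'b"
  assumes closed: "\<And>a b. a \<in> S \<Longrightarrow> b \<in> S \<Longrightarrow> mul a b \<in> S"
    and hom: "\<And>a b. a \<in> S \<Longrightarrow> b \<in> S \<Longrightarrow> \<phi> (mul a b) = mul' (\<phi> a) (\<phi> b)"
    and inj: "inj_on \<phi> S"
begin

lemma idempotents_image:
  assumes "A \<subseteq> S"
  shows "\<phi> ` idempotents mul A = idempotents mul' (\<phi> ` A)"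
proof -
  have "mul' (\<phi> a) (\<phi> a) = \<phi> a \<longleftrightarrow> mul a a = a" if "a \<in> A" for a
    using that assms inj_on_eq_iff[OF inj closed[of a a], of a] hom[of a a] by auto
  then show ?thesis
    by (auto simp: idempotents_def)
qed

lemma regular_elements_image: "\<phi> ` regular_elements mul S = regular_elements mul' (\<phi> ` S)"
proof -
  have "mul' (mul' (\<phi> a) (\<phi> b)) (\<phi> a) = \<phi> a \<longleftrightarrow> mul (mul a b) a = a" if "a \<in> S" "b \<in> S" for a b
    using that inj_on_eq_iff[OF inj closed[of "mul a b" a], of a] hom[of "mul a b" a] hom[of a b]
      closed[of a b] by auto
  then show ?thesis
    by (auto simp: regular_elements_def)
qed

lemma generated_subset: "a \<in> generated_subsemigroup mul X \<Longrightarrow> X \<subseteq> S \<Longrightarrow> a \<in> S"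
  by (induction rule: generated_subsemigroup.induct) (auto intro: closed)

lemma generated_image:
  assumes X: "X \<subseteq> S"
  shows "\<phi> ` generated_subsemigroup mul X = generated_subsemigroup mul' (\<phi> ` X)"
proof (intro equalityI subsetI)
  fix b assume "b \<in> \<phi> ` generated_subsemigroup mul X"
  then obtain a where "a \<in> generated_subsemigroup mul X" "b = \<phi> a"
    by blast
  then show "b \<in> generated_subsemigroup mul' (\<phi> ` X)"
  proof (induction arbitrary: b)
    case (mult a a')
    then show ?case
      using generated_subset[OF _ X] by (auto simp: hom intro: generated_subsemigroup.mult)
  qed (auto intro: generated_subsemigroup.gen)
next
  fix b assume "b \<in> generated_subsemigroup mul' (\<phi> ` X)"
  then show "b \<in> \<phi> ` generated_subsemigroup mul X"
  proof induction
    case (mult b b')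
    then obtain a a' where a: "a \<in> generated_subsemigroup mul X" "a' \<in> generated_subsemigroup mul X"
      "b = \<phi> a" "b' = \<phi> a'"
      by blast
    then have "mul' b b' = \<phi> (mul a a')"
      using generated_subset[OF _ X] by (simp add: hom)
    then show ?case
      using a by (auto intro: generated_subsemigroup.mult)
  qed (auto intro: generated_subsemigroup.gen)
qed

lemma idempotent_generated_image:
  "\<phi> ` idempotent_generated mul S = idempotent_generated mul' (\<phi> ` S)"
  unfolding idempotent_generated_def idempotents_image[OF order_refl, symmetric]
  by (rule generated_image) (auto simp: idempotents_def)

end

theorem theorem5p18:
  fixes m n r :: nat and \<sigma> :: "vertex set set"
  assumes "\<sigma> \<in> PB n m"
    and "r = pb_rank \<sigma>"
  shows "idempotent_generated (sandwich m n \<sigma>) (PB m n) =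
    idempotents (sandwich m n \<sigma>) (DReg m n \<sigma> (int r) \<union> DReg m n \<sigma> (int r - 1)) \<union>
    (\<Union>q\<in>{0..int r - 2}. DReg m n \<sigma> q)"
proof -
  let ?mul = "sandwich m n \<sigma>" and ?S = "PB m n"
  let ?mul' = "\<lambda>a b. a \<odot> rel_of \<sigma> \<odot> b"
  let ?Reg = "PReg m n \<sigma>" and ?Reg' = "regular_elements ?mul' (Hom m n)"
  have closed: "?mul a b \<in> ?S" and hom: "rel_of (?mul a b) = ?mul' (rel_of a) (rel_of b)"
    if "a \<in> ?S" "b \<in> ?S" for a b
    using that assms(1) by (simp_all add: sandwich_def pb_prod_PB[of _ _ m] pb_prod_PB[of _ _ n]
        rel_of_pb_prod[of _ _ m] rel_of_pb_prod[of _ _ n])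
  have inj: "inj_on rel_of ?S" and onto: "rel_of ` ?S = Hom m n"
    using bij_betw_rel_of by (auto simp: bij_betw_def)
  note transfer = closed hom inj
  have Reg_sub: "?Reg \<subseteq> ?S"
    by (auto simp: PReg_def regular_elements_def)
  have Reg_image: "rel_of ` ?Reg = ?Reg'"
    unfolding PReg_def using regular_elements_image[where mul' = ?mul', OF transfer] onto by simp
  have r: "r = rk (rel_of \<sigma>)"
    using assms pb_rank_eq_rk by simp
  let ?top = "{a \<in> ?Reg. pb_rank a = r \<or> pb_rank a + 1 = r}" and ?low = "{a \<in> ?Reg. pb_rank a + 2 \<le> r}"
  have rank_image: "rel_of ` {a \<in> ?Reg. C (pb_rank a)} = {a \<in> ?Reg'. C (rk a)}" for C
    using Reg_sub pb_rank_eq_rk[of _ m n] unfolding Reg_image[symmetric] by fastforce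
  have "DReg m n \<sigma> (int r) \<union> DReg m n \<sigma> (int r - 1) = ?top"
    by (auto simp: DReg_def)
  moreover have "(\<Union>q\<in>{0..int r - 2}. DReg m n \<sigma> q) = ?low"
    by (auto simp: DReg_def)
  moreover have "idempotent_generated ?mul ?S = idempotents ?mul ?top \<union> ?low"
  proof (rule inj_on_image_eq_iff[OF inj, THEN iffD1])
    show "idempotent_generated ?mul ?S \<subseteq> ?S"
      using generated_subset[where mul' = ?mul', OF transfer] by (auto simp: idempotent_generated_def idempotents_def)
    have sub: "?top \<subseteq> ?S" "?low \<subseteq> ?S"
      using Reg_sub by auto
    then show "idempotents ?mul ?top \<union> ?low \<subseteq> ?S"
      by (auto simp: idempotents_def)
    have idem_image: "rel_of ` idempotents ?mul ?top = idempotents ?mul' (rel_of ` ?top)"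
      by (rule idempotents_image[where mul' = ?mul', OF transfer sub(1)])
    have "rel_of ` idempotent_generated ?mul ?S = idempotent_generated ?mul' (Hom m n)"
      using idempotent_generated_image[where mul' = ?mul', OF transfer] onto by simp
    also have "\<dots> = idempotents ?mul' {a \<in> ?Reg'. rk a = r \<or> rk a + 1 = r} \<union> {a \<in> ?Reg'. rk a + 2 \<le> r}"
      unfolding r by (rule idempotent_generated_relations[OF rel_of_Hom[OF assms(1)]])
    also have "\<dots> = rel_of ` (idempotents ?mul ?top \<union> ?low)"
      unfolding image_Un idem_image
      using rank_image[of "\<lambda>k. k = r \<or> k + 1 = r"] rank_image[of "\<lambda>k. k + 2 \<le> r"] by simp
    finally show "rel_of ` idempotent_generated ?mul ?S = rel_of ` (idempotents ?mul ?top \<union> ?low)" .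
  qed
  ultimately show ?thesis
    by simp
qed

end
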